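(* On a distributed-memory machine with $p$ PEs, each holding a subset of the $n$ weighted items and with $k$ known to all PEs, sampling $k$ out of $n$ items with replacement can be done in a communication-free way with processing overhead $O(\log p)$ in addition to the time needed for taking the local samples. Building and distributing the DC-tree for distributing the samples among the PEs is possible in time $O(\alpha\log p)$.
   Context: Sampling with replacement: $k$ independent draws, each equal to item $i$ with probability $w_i/W$, $W=\sum_j w_j$. Distributed-memory model: point-to-point messages, a message of length $\ell$ words costs $\alpha+\ell\beta$, $1\le\beta\le\alpha$. The (top-level) DC-tree here is a binary tree with one leaf per PE, each internal node storing the total item weight of the PEs in its subtree; $k$ samples are distributed by recursively splitting the number $m$ of samples at a node with child weights $L,R$ into $m'\sim\mathrm{Binomial}(m,L/(L+R))$ for the left and $m-m'$ for the right subtree, where all PEs use identical random choices at the same nodes (e.g. by seeding a pseudo-random generator with the node ID), so that each PE learns how many samples to take from its local items. Each PE stores only the partial sums on the path to its leaf. *)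

theory Defs
  imports "HOL-Probability.Probability" "HOL-Library.Multiset"
begin

section \<open>The distributed-memory machine\<close>

text \<open>
  All PEs execute the same finite program (SPMD) on private memory. Machine words are real
  numbers, without a rounding instruction. Instruction arguments are register numbers,
  except for the literal of \<open>Const\<close> (its second argument) and the jump target of \<open>JumpLeq\<close>
  (its third argument, a position in the program).
  \<open>Binom r v m q\<close> puts into \<open>r\<close> a binomial deviate with \<open>m\<close> trials and success probability
  \<open>q\<close>, obtained from the generator that is seeded identically on all PEs with the node ID
  \<open>v\<close>. \<open>Sample m\<close> takes \<open>m\<close> samples from the items held by the executing PE.
  \<open>Send j a l\<close> sends the \<open>l\<close> memory words starting at address \<open>a\<close> to PE \<open>j\<close>;
  \<open>Recv j a\<close> stores a message from PE \<open>j\<close> at address \<open>a\<close>.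
\<close>

datatype arith = Add | Sub | Mul | Div

datatype instr =
    Const nat nat
  | Arith arith nat nat nat
  | Load nat nat
  | Store nat nat
  | JumpLeq nat nat nat
  | Binom nat nat nat nat
  | Sample nat
  | Send nat nat nat
  | Recv nat nat

text \<open>
  \<open>coin (v, m, q)\<close> is the value of the shared generator, \<open>loc (i, m)\<close> the list of local
  samples obtained by PE \<open>i\<close> when it takes \<open>m\<close> samples, and \<open>loc_time i m\<close> the time it
  needs for that. Time is measured in units of one local instruction.
\<close>

record env =
  npes :: nat
  alpha :: real
  beta :: real
  coin :: "nat \<times> nat \<times> real \<Rightarrow> nat"
  loc :: "nat \<times> nat \<Rightarrow> nat list"
  loc_time :: "nat \<Rightarrow> nat \<Rightarrow> real"

record pe_state =
  pc :: nat
  reg :: "nat \<Rightarrow> real"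
  mem :: "nat \<Rightarrow> real"
  clock :: real
  samples :: "nat list"

type_synonym machine_state = "nat \<Rightarrow> pe_state"

definition idx :: "real \<Rightarrow> nat" where
  "idx x = nat \<lfloor>x\<rfloor>"

fun arith_op :: "arith \<Rightarrow> real \<Rightarrow> real \<Rightarrow> real" where
  "arith_op Add x y = x + y"
| "arith_op Sub x y = x - y"
| "arith_op Mul x y = x * y"
| "arith_op Div x y = x / y"

definition halted :: "instr list \<Rightarrow> pe_state \<Rightarrow> bool" where
  "halted P x \<longleftrightarrow> length P \<le> pc x"

definition tick :: "pe_state \<Rightarrow> pe_state" where
  "tick x = x\<lparr>pc := Suc (pc x), clock := clock x + 1\<rparr>"

definition set_reg :: "nat \<Rightarrow> real \<Rightarrow> pe_state \<Rightarrow> pe_state" where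
  "set_reg r a x = x\<lparr>reg := (reg x)(r := a)\<rparr>"

text \<open>Local instructions; communication is handled by \<open>machine_step\<close> below.\<close>

fun exec :: "env \<Rightarrow> nat \<Rightarrow> instr \<Rightarrow> pe_state \<Rightarrow> pe_state" where
  "exec E i (Const r c) x = set_reg r (real c) (tick x)"
| "exec E i (Arith f r a b) x = set_reg r (arith_op f (reg x a) (reg x b)) (tick x)"
| "exec E i (Load r a) x = set_reg r (mem x (idx (reg x a))) (tick x)"
| "exec E i (Store a r) x = (tick x)\<lparr>mem := (mem x)(idx (reg x a) := reg x r)\<rparr>"
| "exec E i (JumpLeq a b l) x =
     (if reg x a \<le> reg x b then (tick x)\<lparr>pc := l\<rparr> else tick x)"
| "exec E i (Binom r v m q) x =
     set_reg r (real (coin E (idx (reg x v), idx (reg x m), reg x q))) (tick x)"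
| "exec E i (Sample m) x =
     (let c = idx (reg x m) in
       (tick x)\<lparr>samples := samples x @ loc E (i, c), clock := clock x + 1 + loc_time E i c\<rparr>)"
| "exec E i (Send j a l) x = x"
| "exec E i (Recv j a) x = x"

text \<open>\<open>sends P x\<close> is \<open>Some (j, msg)\<close> if the next instruction sends \<open>msg\<close> to PE \<open>j\<close>;
  \<open>receives P x\<close> is \<open>Some (j, a)\<close> if it waits for a message from PE \<open>j\<close>, to be stored at \<open>a\<close>.\<close>

definition sends :: "instr list \<Rightarrow> pe_state \<Rightarrow> (nat \<times> real list) option" where
  "sends P x =
     (if halted P x then None
      else case P ! pc x of
        Send j a l \<Rightarrow>
          Some (idx (reg x j), map (mem x) [idx (reg x a) ..< idx (reg x a) + idx (reg x l)])
      | _ \<Rightarrow> None)"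

definition receives :: "instr list \<Rightarrow> pe_state \<Rightarrow> (nat \<times> nat) option" where
  "receives P x =
     (if halted P x then None
      else case P ! pc x of
        Recv j a \<Rightarrow> Some (idx (reg x j), idx (reg x a))
      | _ \<Rightarrow> None)"

definition write_block :: "nat \<Rightarrow> real list \<Rightarrow> (nat \<Rightarrow> real) \<Rightarrow> (nat \<Rightarrow> real)" where
  "write_block a msg \<mu> =
     (\<lambda>c. if a \<le> c \<and> c < a + length msg then msg ! (c - a) else \<mu> c)"

text \<open>Sender and receiver are both occupied from the moment when both are ready until
  the message has been delivered.\<close>

definition comm_end :: "env \<Rightarrow> pe_state \<Rightarrow> pe_state \<Rightarrow> real list \<Rightarrow> real" where
  "comm_end E x y msg = max (clock x) (clock y) + alpha E + real (length msg) * beta E"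

text \<open>
  One step of every PE that is not blocked. A PE at a communication instruction waits until
  its partner arrives at the matching one. PEs determine their partners, so the matching of
  sends and receives is unique, and the clocks do not depend on the lock-step schedule.
\<close>

definition machine_step :: "env \<Rightarrow> instr list \<Rightarrow> machine_state \<Rightarrow> machine_state" where
  "machine_step E P s = (\<lambda>i.
     let x = s i in
     if npes E \<le> i \<or> halted P x then x
     else case sends P x of
       Some (j, msg) \<Rightarrow>
         (if j < npes E \<and> (\<exists>a. receives P (s j) = Some (i, a))
          then x\<lparr>pc := Suc (pc x), clock := comm_end E x (s j) msg\<rparr> else x)
     | None \<Rightarrow>
        (case receives P x of
          Some (j, a) \<Rightarrow>
            (if j < npes E then
               (case sends P (s j) of
                 Some (i', msg) \<Rightarrow>
                   if i' = i
                   then x\<lparr>pc := Suc (pc x), mem := write_block a msg (mem x),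
                          clock := comm_end E x (s j) msg\<rparr>
                   else x
               | None \<Rightarrow> x)
             else x)
        | None \<Rightarrow> exec E i (P ! pc x) x))"

definition all_halted :: "env \<Rightarrow> instr list \<Rightarrow> machine_state \<Rightarrow> bool" where
  "all_halted E P s \<longleftrightarrow> (\<forall>i < npes E. halted P (s i))"

definition terminates :: "env \<Rightarrow> instr list \<Rightarrow> machine_state \<Rightarrow> bool" where
  "terminates E P s \<longleftrightarrow> (\<exists>t. all_halted E P ((machine_step E P ^^ t) s))"

definition final :: "env \<Rightarrow> instr list \<Rightarrow> machine_state \<Rightarrow> machine_state" where
  "final E P s =
     (machine_step E P ^^ (LEAST t. all_halted E P ((machine_step E P ^^ t) s))) s"

definition communication_free :: "instr list \<Rightarrow> bool" where
  "communication_free P \<longleftrightarrow> (\<forall>ins \<in> set P. \<forall>j a l. ins \<noteq> Send j a l \<and> ins \<noteq> Recv j a)"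


section \<open>Weighted draws and the sources of randomness\<close>

definition weighted_pmf :: "'a set \<Rightarrow> ('a \<Rightarrow> real) \<Rightarrow> 'a pmf" where
  "weighted_pmf A w = embed_pmf (\<lambda>x. if x \<in> A then w x / sum w A else 0)"

lemma pmf_weighted_pmf:
  assumes fin: "finite A" and nonneg: "\<And>x. x \<in> A \<Longrightarrow> 0 \<le> w x" and pos: "0 < sum w A"
  shows "pmf (weighted_pmf A w) x = (if x \<in> A then w x / sum w A else 0)"
  unfolding weighted_pmf_def
proof (rule pmf_embed_pmf)
  show "0 \<le> (if x \<in> A then w x / sum w A else 0)" for x
    using nonneg pos by simp
  have "(\<integral>\<^sup>+x. ennreal (if x \<in> A then w x / sum w A else 0) \<partial>count_space UNIV) =
        (\<Sum>x\<in>A. ennreal (if x \<in> A then w x / sum w A else 0))"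
    using fin by (intro nn_integral_count_space') auto
  also have "\<dots> = ennreal (\<Sum>x\<in>A. w x / sum w A)"
    using nonneg pos by (subst sum_ennreal[symmetric]) auto
  also have "(\<Sum>x\<in>A. w x / sum w A) = 1"
    using pos by (simp flip: sum_divide_distrib)
  finally show "(\<integral>\<^sup>+x. ennreal (if x \<in> A then w x / sum w A else 0) \<partial>count_space UNIV) = 1"
    by simp
qed

definition local_items :: "nat \<Rightarrow> (nat \<Rightarrow> nat) \<Rightarrow> nat \<Rightarrow> nat set" where
  "local_items n own i = {j. j < n \<and> own j = i}"

definition local_weight :: "nat \<Rightarrow> (nat \<Rightarrow> nat) \<Rightarrow> (nat \<Rightarrow> real) \<Rightarrow> nat \<Rightarrow> real" where
  "local_weight n own w i = sum w (local_items n own i)"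

text \<open>
  The shared generator yields independent deviates for different seeds and parameters; all
  PEs see the same table. Entries with \<open>q\<close> outside the unit interval, and local draws
  from items of total weight zero, have an unspecified distribution.
\<close>

definition shared_coins :: "(nat \<times> nat \<times> real \<Rightarrow> nat) measure" where
  "shared_coins = PiM UNIV (\<lambda>(v, m, q). measure_pmf (binomial_pmf m q))"

definition local_draws ::
    "nat \<Rightarrow> (nat \<Rightarrow> nat) \<Rightarrow> (nat \<Rightarrow> real) \<Rightarrow> (nat \<times> nat \<Rightarrow> nat list) measure" where
  "local_draws n own w =
     PiM UNIV (\<lambda>(i, m). measure_pmf (replicate_pmf m (weighted_pmf (local_items n own i) w)))"

definition randomness :: "nat \<Rightarrow> (nat \<Rightarrow> nat) \<Rightarrow> (nat \<Rightarrow> real) \<Rightarrow>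
    ((nat \<times> nat \<times> real \<Rightarrow> nat) \<times> (nat \<times> nat \<Rightarrow> nat list)) measure" where
  "randomness n own w = shared_coins \<Otimes>\<^sub>M local_draws n own w"

definition with_randomness ::
    "env \<Rightarrow> (nat \<times> nat \<times> real \<Rightarrow> nat) \<times> (nat \<times> nat \<Rightarrow> nat list) \<Rightarrow> env" where
  "with_randomness E \<omega> = E\<lparr>coin := fst \<omega>, loc := snd \<omega>\<rparr>"

text \<open>The samples are distributed over the PEs, hence they form a multiset.\<close>

definition sample_mset :: "env \<Rightarrow> machine_state \<Rightarrow> nat multiset" where
  "sample_mset E s = (\<Sum>i < npes E. mset (samples (s i)))"


section \<open>The top-level DC-tree\<close>

datatype dctree = Leaf nat real | Node real dctree dctree

fun weight :: "dctree \<Rightarrow> real" where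
  "weight (Leaf i x) = x"
| "weight (Node x l r) = x"

fun pes :: "dctree \<Rightarrow> nat list" where
  "pes (Leaf i x) = [i]"
| "pes (Node x l r) = pes l @ pes r"

fun stores_weights :: "(nat \<Rightarrow> real) \<Rightarrow> dctree \<Rightarrow> bool" where
  "stores_weights W (Leaf i x) \<longleftrightarrow> x = W i"
| "stores_weights W (Node x l r) \<longleftrightarrow>
     x = (\<Sum>i \<in> set (pes (Node x l r)). W i) \<and> stores_weights W l \<and> stores_weights W r"

definition is_dctree :: "nat \<Rightarrow> (nat \<Rightarrow> real) \<Rightarrow> dctree \<Rightarrow> bool" where
  "is_dctree p W t \<longleftrightarrow> distinct (pes t) \<and> set (pes t) = {..<p} \<and> stores_weights W t"

text \<open>
  Number of samples that PE \<open>i\<close> gets when \<open>m\<close> samples are split among the PEs of the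
  tree. The nodes are identified by their heap numbers: the root has ID 1, and the
  children of node \<open>v\<close> have IDs \<open>2 * v\<close> and \<open>2 * v + 1\<close>.
\<close>

fun share :: "(nat \<times> nat \<times> real \<Rightarrow> nat) \<Rightarrow> nat \<Rightarrow> dctree \<Rightarrow> nat \<Rightarrow> nat \<Rightarrow> nat" where
  "share b v (Leaf j x) m i = m"
| "share b v (Node x l r) m i =
     (let m' = b (v, m, weight l / (weight l + weight r))
      in if i \<in> set (pes l) then share b (2 * v) l m' i
         else share b (2 * v + 1) r (m - m') i)"

text \<open>
  What PE \<open>i\<close> knows of the tree: for each internal node on the path from the root to its
  leaf, the weights of both children and whether the path goes left (0) or right (1).
\<close>

fun pe_path :: "nat \<Rightarrow> dctree \<Rightarrow> (real \<times> real \<times> real) list" where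
  "pe_path i (Leaf j x) = []"
| "pe_path i (Node x l r) =
     (if i \<in> set (pes l) then (weight l, weight r, 0) # pe_path i l
      else (weight l, weight r, 1) # pe_path i r)"

definition holds_path :: "dctree \<Rightarrow> nat \<Rightarrow> pe_state \<Rightarrow> bool" where
  "holds_path t i x \<longleftrightarrow>
     reg x 3 = real (length (pe_path i t)) \<and>
     (\<forall>d < length (pe_path i t).
        (mem x (3 * d), mem x (3 * d + 1), mem x (3 * d + 2)) = pe_path i t ! d)"

text \<open>Registers 0 and 1 hold the rank of the PE and the number of PEs. All registers and
  memory cells not mentioned have arbitrary contents.\<close>

definition ready :: "nat \<Rightarrow> nat \<Rightarrow> pe_state \<Rightarrow> bool" where
  "ready p i x \<longleftrightarrow>
     pc x = 0 \<and> clock x = 0 \<and> samples x = [] \<and> reg x 0 = real i \<and> reg x 1 = real p"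

definition build_start :: "nat \<Rightarrow> (nat \<Rightarrow> real) \<Rightarrow> machine_state \<Rightarrow> bool" where
  "build_start p W s \<longleftrightarrow> (\<forall>i < p. ready p i (s i) \<and> reg (s i) 2 = W i)"

definition sample_start :: "nat \<Rightarrow> dctree \<Rightarrow> nat \<Rightarrow> machine_state \<Rightarrow> bool" where
  "sample_start p t k s \<longleftrightarrow>
     (\<forall>i < p. ready p i (s i) \<and> reg (s i) 2 = real k \<and> holds_path t i (s i))"

end

theory Submission
  imports Defs
begin

text \<open>
  Let \<open>2 ^ h \<le> p < 2 ^ (h + 1)\<close>. The tree splits the PEs by the bits of their ranks, lowest bit at
  the root, so that its depth is at most \<open>h + 1\<close>. Every PE \<open>i \<ge> 2 ^ h\<close> first exchanges weights with
  its sibling leaf \<open>i - 2 ^ h\<close>; then the PEs below \<open>2 ^ h\<close> run a butterfly exchange in which the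
  bits \<open>h - 1, \<dots>, 0\<close> are processed, each round yielding one more node of the path to the
  root; finally \<open>i - 2 ^ h\<close> forwards its \<open>3 * h\<close> path words to \<open>i\<close>, which costs
  \<open>\<alpha> + 3 * h * \<beta> \<le> \<alpha> * (1 + 3 * h)\<close>. The branches of the program are padded to equal
  length, so that all PEs enter each phase in the same machine step.

  Sampling walks down the stored path, and its final state is known for every outcome of the
  generators. In a fixed subtree the coins and local draws used by the two children have disjoint
  coordinates in the product space, hence they are independent, and the law of the samples satisfies
  the recursion of the tree. Each level of this recursion is the binomial splitting of draws from
  a mixture.
\<close>

section \<open>The law of the samples drawn along a tree\<close>

text \<open>The coin table has a real-valued component in its key, so it is an uncountable product
  and its law is not a \<open>pmf\<close>. Moreover, the key read at a child contains the number of
  trials, which the parent's coin decides, so the coordinates that are read are themselves random.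
  Independence is therefore applied only after the parent's deviate has been fixed to a value
  \<open>a\<close>, followed by a sum over \<open>a\<close>: for fixed \<open>a\<close> the factors
  depend on fixed blocks of coordinates. The local draws are integrated out before the coins, which
  separates independence between PEs from independence between node IDs.

  Subtrees of weight zero are legal, and local draws there have an unspecified law. They do no harm:
  the splitting probability next to such a subtree is 0 or 1, so that it receives no samples.

  Coins exceeding the number of trials form legal outcomes as well; the analysis of the sampling
  program covers them because the conversion of reals to numbers truncates in the same way as
  subtraction on naturals.\<close>

lemma PiM_pmf_nn_integral_prod:
  fixes D :: "'i \<Rightarrow> 'a pmf" and F :: "'j \<Rightarrow> ('i \<Rightarrow> 'a) \<Rightarrow> ennreal"
  defines "M \<equiv> PiM UNIV (\<lambda>i. measure_pmf (D i))"
  assumes J: "finite J" and disj: "disjoint_family_on K J"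
    and local: "\<And>j x y. j \<in> J \<Longrightarrow> (\<And>i. i \<in> K j \<Longrightarrow> x i = y i) \<Longrightarrow> F j x = F j y"
    and meas: "\<And>j. j \<in> J \<Longrightarrow> F j \<in> borel_measurable M"
  shows "(\<integral>\<^sup>+x. (\<Prod>j\<in>J. F j x) \<partial>M) = (\<Prod>j\<in>J. \<integral>\<^sup>+x. F j x \<partial>M)"
proof -
  interpret prob_space M
    unfolding M_def by (intro prob_space_PiM prob_space_measure_pmf)
  have comp: "distr M (measure_pmf (D i)) (\<lambda>x. x i) = measure_pmf (D i)" for i
    unfolding M_def by (rule distr_PiM_component) (auto intro: prob_space_measure_pmf)
  \<comment> \<open>The tuple of all coordinates is the identity, so independence amounts to
    \<open>M\<close> being the product of its own marginals.\<close>
  have coord: "indep_vars (\<lambda>i. measure_pmf (D i)) (\<lambda>i x. x i) UNIV"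
  proof (subst indep_vars_iff_distr_eq_PiM)
    show "random_variable (measure_pmf (D i)) (\<lambda>x. x i)" for i
      unfolding M_def by simp
    have "distr M (Pi\<^sub>M UNIV (\<lambda>i. measure_pmf (D i))) (\<lambda>x. restrict x UNIV) = distr M M (\<lambda>x. x)"
      by (rule distr_cong) (simp_all add: M_def restrict_def)
    then show "distr M (Pi\<^sub>M UNIV (\<lambda>i. measure_pmf (D i))) (\<lambda>x. \<lambda>i\<in>UNIV. x i) =
        Pi\<^sub>M UNIV (\<lambda>i. distr M (measure_pmf (D i)) (\<lambda>x. x i))"
      unfolding comp by (simp add: M_def)
  qed simp
  \<comment> \<open>\<open>F j\<close> takes total tables, while independence of blocks speaks of
    restrictions to \<open>K j\<close>. \<open>G j\<close> fills the missing coordinates with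
    \<open>undefined\<close>; by locality this does not change the value.\<close>
  define G where "G j y = F j (\<lambda>i. if i \<in> K j then y i else undefined)" for j y
  have G: "G j \<in> borel_measurable (PiM (K j) (\<lambda>i. measure_pmf (D i)))" if "j \<in> J" for j
  proof -
    have "(\<lambda>y i. if i \<in> K j then y i else undefined) \<in>
        PiM (K j) (\<lambda>i. measure_pmf (D i)) \<rightarrow>\<^sub>M M"
      unfolding M_def
    proof (rule measurable_PiM_single')
      show "(\<lambda>y. if i \<in> K j then y i else undefined) \<in>
          PiM (K j) (\<lambda>i. measure_pmf (D i)) \<rightarrow>\<^sub>M measure_pmf (D i)" for i
        by (cases "i \<in> K j") auto
    qed auto
    from measurable_compose[OF this meas[OF that]] show ?thesis
      by (simp add: G_def[abs_def])
  qed
  have "indep_vars (\<lambda>_. borel) (\<lambda>j x. G j (restrict x (K j))) J"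
    by (rule indep_vars_compose2[OF indep_vars_restrict[OF coord _ disj] G]) auto
  moreover have "G j (restrict x (K j)) = F j x" if "j \<in> J" for j x
    unfolding G_def by (rule local[OF that]) simp
  ultimately have "indep_vars (\<lambda>_. borel) F J"
    by (subst (asm) indep_vars_cong) auto
  then show ?thesis
    by (intro indep_vars_nn_integral J) auto
qed

text \<open>All samples below a node by recursion on the tree, the form needed for an induction on
  laws; \<open>share\<close> follows the path of a single PE instead.\<close>

fun draws :: "(nat \<times> nat \<times> real \<Rightarrow> nat) \<Rightarrow> (nat \<times> nat \<Rightarrow> nat list) \<Rightarrow>
    nat \<Rightarrow> dctree \<Rightarrow> nat \<Rightarrow> nat multiset" where
  "draws b f v (Leaf j x) m = mset (f (j, m))"
| "draws b f v (Node x l r) m =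
     (let m' = b (v, m, weight l / (weight l + weight r))
      in draws b f (2 * v) l m' + draws b f (2 * v + 1) r (m - m'))"

text \<open>As the PEs are distinct, a PE of the right subtree does not occur in the left one, so
  \<open>share\<close> takes the branch in which \<open>draws\<close> counts its samples.\<close>

lemma draws_eq_sum:
  "distinct (pes t) \<Longrightarrow> draws b f v t m = (\<Sum>i\<in>set (pes t). mset (f (i, share b v t m i)))"
proof (induction t arbitrary: v m)
  case (Node x l r)
  then have "set (pes l) \<inter> set (pes r) = {}" by auto
  with Node show ?case
    by (auto simp: Let_def sum.union_disjoint intro!: arg_cong2[where f = "(+)"] sum.cong)
qed simp

section \<open>Node IDs in heap order\<close>

definition heap_subtree :: "nat \<Rightarrow> nat set" where
  "heap_subtree v = {u. \<exists>e. u div 2 ^ e = v}"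

lemma self_in_heap_subtree: "v \<in> heap_subtree v"
  unfolding heap_subtree_def by (auto intro: exI[of _ 0])

lemma heap_subtree_children: "u \<in> heap_subtree (2 * v) \<union> heap_subtree (2 * v + 1) \<Longrightarrow> u \<in> heap_subtree v"
proof -
  assume "u \<in> heap_subtree (2 * v) \<union> heap_subtree (2 * v + 1)"
  then obtain e where "u div 2 ^ e = 2 * v \<or> u div 2 ^ e = 2 * v + 1"
    unfolding heap_subtree_def by auto
  then have "u div 2 ^ Suc e = v"
    by (auto simp: div_mult2_eq power_Suc2 simp del: power_Suc)
  then show ?thesis unfolding heap_subtree_def by blast
qed

lemma heap_subtree_ge: "u \<in> heap_subtree v \<Longrightarrow> v \<le> u"
  unfolding heap_subtree_def by auto

text \<open>The ancestors of one node form a chain, on which the larger ID is the deeper one. ID 0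
  is the exception, being its own half.\<close>

lemma heap_subtree_inter:
  assumes "u \<in> heap_subtree a" "u \<in> heap_subtree b" "a \<le> b"
  shows "b \<in> heap_subtree a \<or> a = 0"
proof -
  from assms(1,2) obtain e f where e: "u div 2 ^ e = a" and f: "u div 2 ^ f = b"
    unfolding heap_subtree_def by auto
  show ?thesis
  proof (cases "f \<le> e")
    case True
    have "b div 2 ^ (e - f) = a"
      unfolding e[symmetric] f[symmetric] using True
      by (simp add: div_mult2_eq[symmetric] power_add[symmetric])
    then show ?thesis unfolding heap_subtree_def by blast
  next
    case False
    then obtain g where g: "f = e + Suc g"
      using less_iff_Suc_add by (metis add_Suc_right not_le)
    have "a div 2 ^ Suc g = b"
      unfolding e[symmetric] f[symmetric] g
      by (simp only: div_mult2_eq[symmetric] power_add[symmetric])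
    moreover have "a div 2 ^ Suc g \<le> a div 2"
      by (rule div_le_mono2) auto
    ultimately show ?thesis using \<open>a \<le> b\<close> by linarith
  qed
qed

text \<open>Otherwise the larger sibling would descend from the smaller one, but halving
  \<open>2 * v + 1\<close> at least once gives at most \<open>v < 2 * v\<close>.\<close>

lemma heap_subtree_siblings_disjoint:
  assumes "1 \<le> v" shows "heap_subtree (2 * v) \<inter> heap_subtree (2 * v + 1) = {}"
proof (rule ccontr)
  assume "\<not> ?thesis"
  then have "2 * v + 1 \<in> heap_subtree (2 * v)"
    using heap_subtree_inter[of _ "2 * v" "2 * v + 1"] assms by auto
  then obtain e where e: "(2 * v + 1) div 2 ^ e = 2 * v" unfolding heap_subtree_def by auto
  show False
  proof (cases e)
    case (Suc e')
    have "(2 * v + 1) div 2 ^ e \<le> (2 * v + 1) div 2"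
      unfolding Suc by (rule div_le_mono2) auto
    then show ?thesis using e assms by simp
  qed (use e in simp)
qed

lemma parent_notin_heap_subtree:
  assumes "1 \<le> v" shows "v \<notin> heap_subtree (2 * v)" "v \<notin> heap_subtree (2 * v + 1)"
  using heap_subtree_ge[of v "2 * v"] heap_subtree_ge[of v "2 * v + 1"] assms by auto

text \<open>Locality: this is the block of coordinates required by
  \<open>PiM_pmf_nn_integral_prod\<close>. It contains all keys of a node ID because the trial count
  is not known in advance.\<close>

lemma draws_cong:
  assumes "\<And>u m q. u \<in> heap_subtree v \<Longrightarrow> b (u, m, q) = b' (u, m, q)"
    and "\<And>i m. i \<in> set (pes t) \<Longrightarrow> f (i, m) = f' (i, m)"
  shows "draws b f v t m = draws b' f' v t m"
  using assms
proof (induction t arbitrary: v m)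
  case (Node x l r)
  have "draws b f (2 * v) l a = draws b' f' (2 * v) l a" for a
  proof (rule Node.IH(1))
    show "b (u, m, q) = b' (u, m, q)" if "u \<in> heap_subtree (2 * v)" for u m q
      using that Node.prems(1) heap_subtree_children by blast
    show "f (i, m) = f' (i, m)" if "i \<in> set (pes l)" for i m
      using that Node.prems(2) by simp
  qed
  moreover have "draws b f (2 * v + 1) r a = draws b' f' (2 * v + 1) r a" for a
  proof (rule Node.IH(2))
    show "b (u, m, q) = b' (u, m, q)" if "u \<in> heap_subtree (2 * v + 1)" for u m q
      using that Node.prems(1) heap_subtree_children by blast
    show "f (i, m) = f' (i, m)" if "i \<in> set (pes r)" for i m
      using that Node.prems(2) by simp
  qed
  ultimately show ?case
    using Node.prems(1)[OF self_in_heap_subtree] by (simp add: Let_def)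
qed simp

section \<open>Sums of independent random multisets\<close>

lemma countable_multisets: "countable (UNIV :: nat multiset set)"
proof -
  have "(UNIV :: nat multiset set) = range mset" using surj_mset by auto
  then show ?thesis by (metis countable_image countableI_type)
qed

lemma finite_submultisets: "finite {B. B \<subseteq># (A :: 'a multiset)}"
proof (induction A)
  case (add x A)
  have "{B. B \<subseteq># add_mset x A} \<subseteq> {B. B \<subseteq># A} \<union> add_mset x ` {B. B \<subseteq># A}"
  proof
    fix B assume B: "B \<in> {B. B \<subseteq># add_mset x A}"
    show "B \<in> {B. B \<subseteq># A} \<union> add_mset x ` {B. B \<subseteq># A}"
    proof (cases "x \<in># B")
      case True
      then obtain B' where "B = add_mset x B'" by (metis insert_DiffM)
      with B show ?thesis by auto
    next
      case False
      with B have "B \<subseteq># A"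
        by (auto simp: subseteq_mset_def not_in_iff) (metis le0)
      then show ?thesis by simp
    qed
  qed
  then show ?case using add finite_subset by blast
qed simp

text \<open>Only \<open>B = X\<close> can contribute. The finite sum turns an event about
  \<open>X + Y\<close> into products of events about \<open>X\<close> and \<open>Y\<close>, to which
  independence applies.\<close>

lemma indicator_msum:
  fixes X Y A :: "'a multiset"
  shows "(indicator {A} (X + Y) :: ennreal) =
    (\<Sum>B | B \<subseteq># A. indicator {B} X * indicator {A - B} Y)"
proof (cases "X + Y = A")
  case True
  have "(\<Sum>B | B \<subseteq># A. indicator {B} X * indicator {A - B} Y :: ennreal) =
      (\<Sum>B | B \<subseteq># A. if B = X then 1 else 0)"
    using True by (intro sum.cong) (auto simp: indicator_def)
  also have "\<dots> = 1" using True finite_submultisets[of A] by (subst sum.delta) auto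
  finally show ?thesis using True by simp
next
  case False
  then have "indicator {B} X * indicator {A - B} Y = (0 :: ennreal)" if "B \<subseteq># A" for B
    using that by (auto simp: indicator_def)
  then have "(\<Sum>B | B \<subseteq># A. indicator {B} X * indicator {A - B} Y :: ennreal) = 0"
    by (intro sum.neutral) blast
  with False show ?thesis by simp
qed

text \<open>Convolution: the law of the sum of two independent multisets.\<close>

definition msum_pmf :: "'a multiset pmf \<Rightarrow> 'a multiset pmf \<Rightarrow> 'a multiset pmf" where
  "msum_pmf p q = do {B \<leftarrow> p; C \<leftarrow> q; return_pmf (B + C)}"

lemma pmf_msum_pmf:
  "ennreal (pmf (msum_pmf p q) A) =
     (\<Sum>B | B \<subseteq># A. ennreal (pmf p B) * ennreal (pmf q (A - B)))"
proof -
  have "ennreal (pmf (msum_pmf p q) A) =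
      (\<integral>\<^sup>+B. \<integral>\<^sup>+C. indicator {A} (B + C) \<partial>measure_pmf q \<partial>measure_pmf p)"
    unfolding msum_pmf_def by (simp add: ennreal_pmf_bind ennreal_indicator)
  also have "\<dots> = (\<Sum>S | S \<subseteq># A.
      \<integral>\<^sup>+B. \<integral>\<^sup>+C. indicator {S} B * indicator {A - S} C \<partial>measure_pmf q \<partial>measure_pmf p)"
    by (simp add: indicator_msum nn_integral_sum)
  also have "\<dots> = (\<Sum>B | B \<subseteq># A. ennreal (pmf p B) * ennreal (pmf q (A - B)))"
    by (simp add: nn_integral_cmult nn_integral_multc emeasure_pmf_single)
  finally show ?thesis .
qed

text \<open>The target law, in which every node uses fresh randomness instead of entries of a shared
  table.\<close>

fun draws_pmf :: "(nat \<Rightarrow> 'a pmf) \<Rightarrow> dctree \<Rightarrow> nat \<Rightarrow> 'a multiset pmf" where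
  "draws_pmf D (Leaf j x) m = map_pmf mset (replicate_pmf m (D j))"
| "draws_pmf D (Node x l r) m =
     do {a \<leftarrow> binomial_pmf m (weight l / (weight l + weight r));
         msum_pmf (draws_pmf D l a) (draws_pmf D r (m - a))}"

section \<open>The law of the samples under the product measure\<close>

context
  fixes n :: nat and own :: "nat \<Rightarrow> nat" and w :: "nat \<Rightarrow> real"
begin

text \<open>Puts \<open>measure_pmf\<close> outside the case distinction, the shape in which the
  general product lemma applies.\<close>

lemma shared_coins_eq:
  "shared_coins = PiM UNIV (\<lambda>x. measure_pmf (case x of (v, m, q) \<Rightarrow> binomial_pmf m q))"
  unfolding shared_coins_def by (rule arg_cong[where f = "PiM UNIV"]) auto

lemma local_draws_eq:
  "local_draws n own w = PiM UNIV (\<lambda>x. measure_pmf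
     (case x of (i, m) \<Rightarrow> replicate_pmf m (weighted_pmf (local_items n own i) w)))"
  unfolding local_draws_def by (rule arg_cong[where f = "PiM UNIV"]) auto

lemma prob_space_shared_coins: "prob_space shared_coins"
  unfolding shared_coins_eq by (intro prob_space_PiM prob_space_measure_pmf)

lemma prob_space_local_draws: "prob_space (local_draws n own w)"
  unfolding local_draws_eq by (intro prob_space_PiM prob_space_measure_pmf)

interpretation coins: prob_space shared_coins by (rule prob_space_shared_coins)
interpretation locals: prob_space "local_draws n own w" by (rule prob_space_local_draws)

lemma measurable_coin [measurable]: "(\<lambda>b. b x) \<in> shared_coins \<rightarrow>\<^sub>M count_space UNIV"
proof -
  have "(\<lambda>b. b x) \<in> shared_coins \<rightarrow>\<^sub>M measure_pmf (case x of (v, m, q) \<Rightarrow> binomial_pmf m q)"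
    unfolding shared_coins_eq by simp
  then show ?thesis by simp
qed

lemma measurable_loc [measurable]: "(\<lambda>f. f x) \<in> local_draws n own w \<rightarrow>\<^sub>M count_space UNIV"
proof -
  have "(\<lambda>b. b x) \<in> local_draws n own w \<rightarrow>\<^sub>M
      measure_pmf (case x of (i, m) \<Rightarrow> replicate_pmf m (weighted_pmf (local_items n own i) w))"
    unfolding local_draws_eq by simp
  then show ?thesis by simp
qed

text \<open>The argument passed to the children is random. It has countably many values, and for
  each of them the children are measurable by induction; their sum is handled likewise, using that
  multisets are countable.\<close>

lemma measurable_draws [measurable]:
  "(\<lambda>(b, f). draws b f v t m) \<in> shared_coins \<Otimes>\<^sub>M local_draws n own w \<rightarrow>\<^sub>M count_space UNIV"
proof (induction t arbitrary: v m)
  case (Leaf j x)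
  have "(\<lambda>\<omega>. mset (snd \<omega> (j, m))) \<in>
      shared_coins \<Otimes>\<^sub>M local_draws n own w \<rightarrow>\<^sub>M count_space UNIV"
    by measurable
  then show ?case by (simp add: case_prod_unfold)
next
  case (Node x l r)
  let ?M = "shared_coins \<Otimes>\<^sub>M local_draws n own w"
  let ?q = "weight l / (weight l + weight r)"
  have l: "(\<lambda>\<omega>. draws (fst \<omega>) (snd \<omega>) (2 * v) l a) \<in> ?M \<rightarrow>\<^sub>M count_space UNIV" for a
    using Node.IH(1)[of "2 * v" a] by (simp add: case_prod_unfold)
  have r: "(\<lambda>\<omega>. draws (fst \<omega>) (snd \<omega>) (2 * v + 1) r a) \<in> ?M \<rightarrow>\<^sub>M count_space UNIV" for a
    using Node.IH(2)[of "2 * v + 1" a] by (simp add: case_prod_unfold)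
  have s: "(\<lambda>\<omega>. draws (fst \<omega>) (snd \<omega>) (2 * v) l a +
      draws (fst \<omega>) (snd \<omega>) (2 * v + 1) r (m - a)) \<in> ?M \<rightarrow>\<^sub>M count_space UNIV" for a
  proof (rule measurable_compose_countable'[where I = UNIV, OF _ l])
    show "(\<lambda>\<omega>. B + draws (fst \<omega>) (snd \<omega>) (2 * v + 1) r (m - a)) \<in>
        ?M \<rightarrow>\<^sub>M count_space UNIV" for B
      by (rule measurable_compose[OF r]) simp
  qed (rule countable_multisets)
  have c: "(\<lambda>\<omega>. fst \<omega> (v, m, ?q)) \<in> ?M \<rightarrow>\<^sub>M count_space UNIV"
    by measurable
  show ?case
    using measurable_compose_countable[OF s c] by (simp add: Let_def case_prod_unfold)
qed

lemma measurable_indicator_draws [measurable]: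
  "(\<lambda>(b, f). indicator {A} (draws b f v t m) :: ennreal) \<in>
     borel_measurable (shared_coins \<Otimes>\<^sub>M local_draws n own w)"
  using measurable_compose[OF measurable_draws, of "indicator {A}" borel]
  by (simp add: case_prod_unfold)

text \<open>The conditional probability of drawing \<open>A\<close> given the coins: only the local
  draws are integrated.\<close>

definition hit :: "(nat \<times> nat \<times> real \<Rightarrow> nat) \<Rightarrow> nat \<Rightarrow> dctree \<Rightarrow> nat \<Rightarrow> nat multiset \<Rightarrow> ennreal" where
  "hit b v t m A = (\<integral>\<^sup>+f. indicator {A} (draws b f v t m) \<partial>local_draws n own w)"

lemma measurable_hit [measurable]: "(\<lambda>b. hit b v t m A) \<in> borel_measurable shared_coins"
  unfolding hit_def by measurable

lemma space_coins: "space shared_coins = UNIV"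
  by (simp add: shared_coins_def space_PiM split_beta)

lemma measurable_indicator_draws_loc:
  "(\<lambda>f. indicator {A} (draws b f v t m) :: ennreal) \<in> borel_measurable (local_draws n own w)"
proof -
  have "(\<lambda>f. (b, f)) \<in> local_draws n own w \<rightarrow>\<^sub>M shared_coins \<Otimes>\<^sub>M local_draws n own w"
    by (rule measurable_Pair1') (simp add: space_coins)
  from measurable_compose[OF this measurable_indicator_draws] show ?thesis by simp
qed

text \<open>With the coins fixed, the two children read local draws of disjoint sets of PEs, so each
  term of \<open>indicator_msum\<close> factorises under the integral.\<close>

lemma hit_Node:
  assumes "distinct (pes (Node x l r))"
  shows "hit b v (Node x l r) m A =
    (let a = b (v, m, weight l / (weight l + weight r)) in
      \<Sum>B | B \<subseteq># A. hit b (2 * v) l a B * hit b (2 * v + 1) r (m - a) (A - B))"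
proof -
  define a where "a = b (v, m, weight l / (weight l + weight r))"
  let ?L = "local_draws n own w"
  have *: "(\<integral>\<^sup>+f. indicator {B} (draws b f (2 * v) l a) *
      indicator {A - B} (draws b f (2 * v + 1) r (m - a)) \<partial>?L) =
      hit b (2 * v) l a B * hit b (2 * v + 1) r (m - a) (A - B)" for B
  proof -
    define F where "F c f = (if c then indicator {B} (draws b f (2 * v) l a) else
      indicator {A - B} (draws b f (2 * v + 1) r (m - a)) :: ennreal)" for c f
    have "(\<integral>\<^sup>+f. (\<Prod>c\<in>{True, False}. F c f) \<partial>?L) = (\<Prod>c\<in>{True, False}. \<integral>\<^sup>+f. F c f \<partial>?L)"
      unfolding local_draws_eq
    proof (rule PiM_pmf_nn_integral_prod
        [where K = "\<lambda>c. (if c then set (pes l) else set (pes r)) \<times> UNIV"],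
        unfold local_draws_eq[symmetric])
      show "disjoint_family_on (\<lambda>c. (if c then set (pes l) else set (pes r)) \<times> UNIV) {True, False}"
        using assms by (auto simp: disjoint_family_on_def)
      show "F c \<in> borel_measurable ?L" for c
        unfolding F_def using measurable_indicator_draws_loc by (cases c) simp_all
      show "F c f = F c f'"
        if eq: "\<And>i. i \<in> (if c then set (pes l) else set (pes r)) \<times> UNIV \<Longrightarrow> f i = f' i" for c f f'
      proof (cases c)
        case True
        then have "draws b f (2 * v) l a = draws b f' (2 * v) l a"
          using eq by (intro draws_cong) auto
        then show ?thesis using True by (simp add: F_def)
      next
        case False
        then have "draws b f (2 * v + 1) r (m - a) = draws b f' (2 * v + 1) r (m - a)"
          using eq by (intro draws_cong) auto
        then show ?thesis using False by (simp add: F_def)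
      qed
    qed simp
    then show ?thesis by (simp add: F_def hit_def)
  qed
  have "hit b v (Node x l r) m A = (\<integral>\<^sup>+f. (\<Sum>B | B \<subseteq># A. indicator {B} (draws b f (2 * v) l a) *
      indicator {A - B} (draws b f (2 * v + 1) r (m - a))) \<partial>?L)"
    unfolding hit_def by (simp add: Let_def indicator_msum a_def)
  also have "\<dots> = (\<Sum>B | B \<subseteq># A. hit b (2 * v) l a B * hit b (2 * v + 1) r (m - a) (A - B))"
    unfolding *[symmetric]
    by (rule nn_integral_sum) (intro borel_measurable_times_ennreal measurable_indicator_draws_loc)
  finally show ?thesis by (simp add: a_def Let_def)
qed

lemma hit_cong: "(\<And>u m q. u \<in> heap_subtree v \<Longrightarrow> b (u, m, q) = b' (u, m, q)) \<Longrightarrow>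
    hit b v t m A = hit b' v t m A"
  unfolding hit_def
  by (rule nn_integral_cong, rule arg_cong[where f = "indicator {A}"], rule draws_cong) simp_all

text \<open>Induction over the tree that trades table entries for fresh randomness. The root ID is
  positive since node 0 would be its own left child and share its coins.\<close>

lemma nn_integral_hit:
  assumes "distinct (pes t)" "1 \<le> v"
  shows "(\<integral>\<^sup>+b. hit b v t m A \<partial>shared_coins) =
    ennreal (pmf (draws_pmf (\<lambda>i. weighted_pmf (local_items n own i) w) t m) A)"
  using assms
proof (induction t arbitrary: v m A)
  case (Leaf j x)
  let ?D = "replicate_pmf m (weighted_pmf (local_items n own j) w)"
  have "distr (local_draws n own w) (measure_pmf ?D) (\<lambda>f. f (j, m)) = measure_pmf ?D"
    unfolding local_draws_eq
    using distr_PiM_component[of UNIV "\<lambda>x. measure_pmf (case x of (i, m) \<Rightarrow>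
      replicate_pmf m (weighted_pmf (local_items n own i) w))" "(j, m)"]
    by (simp add: prob_space_measure_pmf)
  then have "(\<integral>\<^sup>+y. indicator {A} (mset y) \<partial>measure_pmf ?D) =
      (\<integral>\<^sup>+y. indicator {A} (mset y) \<partial>distr (local_draws n own w) (measure_pmf ?D) (\<lambda>f. f (j, m)))"
    by simp
  also have "\<dots> = (\<integral>\<^sup>+f. indicator {A} (mset (f (j, m))) \<partial>local_draws n own w)"
    by (rule nn_integral_distr) simp_all
  finally have "hit b v (Leaf j x) m A = (\<integral>\<^sup>+y. indicator {A} (mset y) \<partial>measure_pmf ?D)" for b
    by (simp add: hit_def)
  also have "\<dots> = (\<integral>\<^sup>+y. indicator (mset -` {A}) y \<partial>measure_pmf ?D)"
    by (intro nn_integral_cong) (simp add: indicator_def)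
  finally show ?case
    by (simp add: coins.emeasure_space_1 ennreal_pmf_map)
next
  case (Node x l r)
  let ?D = "\<lambda>i. weighted_pmf (local_items n own i) w"
  define q where "q = weight l / (weight l + weight r)"
  note IH = Node.IH(1)[of "2 * v"] Node.IH(2)[of "2 * v + 1"]
  \<comment> \<open>For fixed \<open>a\<close> the children are asked for \<open>a\<close> and
    \<open>m - a\<close> samples. The three factors read the coins of node \<open>v\<close> and
    those with IDs below its left and right child.\<close>
  have *: "(\<integral>\<^sup>+b. indicator {a} (b (v, m, q)) * (hit b (2 * v) l a B *
      hit b (2 * v + 1) r (m - a) (A - B)) \<partial>shared_coins) =
      ennreal (pmf (binomial_pmf m q) a) *
      (ennreal (pmf (draws_pmf ?D l a) B) * ennreal (pmf (draws_pmf ?D r (m - a)) (A - B)))" for a B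
  proof -
    define F where "F j b = (if j = 0 then indicator {a} (b (v, m, q))
      else if j = 1 then hit b (2 * v) l a B
      else hit b (2 * v + 1) r (m - a) (A - B) :: ennreal)" for j :: nat and b
    define K where "K j = (if j = 0 then {v} else if j = 1 then heap_subtree (2 * v)
      else heap_subtree (2 * v + 1)) \<times> (UNIV :: (nat \<times> real) set)" for j :: nat
    have "(\<integral>\<^sup>+b. (\<Prod>j\<in>{0, 1, 2}. F j b) \<partial>shared_coins) =
        (\<Prod>j\<in>{0, 1, 2}. \<integral>\<^sup>+b. F j b \<partial>shared_coins)"
      unfolding shared_coins_eq
    proof (rule PiM_pmf_nn_integral_prod[where K = K], unfold shared_coins_eq[symmetric])
      show "disjoint_family_on K {0, 1, 2}"
        using heap_subtree_siblings_disjoint[OF Node.prems(2)] parent_notin_heap_subtree[OF Node.prems(2)]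
        by (auto simp: disjoint_family_on_def K_def)
      show "F j \<in> borel_measurable shared_coins" for j
        unfolding F_def by (cases "j = 0"; cases "j = 1") (simp_all add: measurable_compose[OF measurable_coin])
      show "F j b = F j b'" if eq: "\<And>i. i \<in> K j \<Longrightarrow> b i = b' i" for j b b'
      proof -
        consider "j = 0" | "j = 1" | "j \<noteq> 0" "j \<noteq> 1" by blast
        then show ?thesis
        proof cases
          case 1
          then show ?thesis using eq by (simp add: F_def K_def)
        next
          case 2
          then have "hit b (2 * v) l a B = hit b' (2 * v) l a B"
            using eq by (intro hit_cong) (auto simp: K_def)
          then show ?thesis using 2 by (simp add: F_def)
        next
          case 3
          then have "hit b (2 * v + 1) r (m - a) (A - B) = hit b' (2 * v + 1) r (m - a) (A - B)"
            using eq by (intro hit_cong) (auto simp: K_def)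
          then show ?thesis using 3 by (simp add: F_def)
        qed
      qed
    qed simp
    moreover have "(\<integral>\<^sup>+b. indicator {a} (b (v, m, q)) \<partial>shared_coins) =
        ennreal (pmf (binomial_pmf m q) a)"
    proof -
      have "distr shared_coins (measure_pmf (binomial_pmf m q)) (\<lambda>b. b (v, m, q)) =
          measure_pmf (binomial_pmf m q)"
        unfolding shared_coins_eq
        using distr_PiM_component[of UNIV "\<lambda>x. measure_pmf (case x of (v, m, q) \<Rightarrow>
          binomial_pmf m q)" "(v, m, q)"]
        by (simp add: prob_space_measure_pmf)
      then have "(\<integral>\<^sup>+y. indicator {a} y \<partial>measure_pmf (binomial_pmf m q)) =
          (\<integral>\<^sup>+y. indicator {a} y \<partial>distr shared_coins (measure_pmf (binomial_pmf m q)) (\<lambda>b. b (v, m, q)))"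
        by simp
      also have "\<dots> = (\<integral>\<^sup>+b. indicator {a} (b (v, m, q)) \<partial>shared_coins)"
        by (rule nn_integral_distr) simp_all
      finally show ?thesis by (simp add: emeasure_pmf_single)
    qed
    ultimately show ?thesis
      using Node.prems IH by (simp add: F_def)
  qed
  \<comment> \<open>The indicator picks the actual deviate out of a sum over all naturals, which
    turns the random arguments of the children into constants.\<close>
  have split: "hit b v (Node x l r) m A = (\<Sum>a. \<Sum>B | B \<subseteq># A. indicator {a} (b (v, m, q)) *
      (hit b (2 * v) l a B * hit b (2 * v + 1) r (m - a) (A - B)))" for b
  proof -
    have "(\<Sum>a. \<Sum>B | B \<subseteq># A. indicator {a} (b (v, m, q)) *
        (hit b (2 * v) l a B * hit b (2 * v + 1) r (m - a) (A - B))) =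
      (\<Sum>a\<in>{b (v, m, q)}. \<Sum>B | B \<subseteq># A. indicator {a} (b (v, m, q)) *
        (hit b (2 * v) l a B * hit b (2 * v + 1) r (m - a) (A - B)))"
      by (rule suminf_finite) (auto simp: indicator_def)
    then show ?thesis
      unfolding hit_Node[OF Node.prems(1)] by (simp add: q_def Let_def)
  qed
  have "(\<integral>\<^sup>+b. hit b v (Node x l r) m A \<partial>shared_coins) =
      (\<Sum>a. \<Sum>B | B \<subseteq># A. \<integral>\<^sup>+b. indicator {a} (b (v, m, q)) *
      (hit b (2 * v) l a B * hit b (2 * v + 1) r (m - a) (A - B)) \<partial>shared_coins)"
  proof -
    have meas: "(\<lambda>b. indicator {a} (b (v, m, q)) * (hit b (2 * v) l a B *
        hit b (2 * v + 1) r (m - a) (A - B))) \<in> borel_measurable shared_coins" for a B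
      by (intro borel_measurable_times_ennreal measurable_hit
        measurable_compose[OF measurable_coin]) simp
    show ?thesis
      unfolding split
      by (subst nn_integral_suminf[OF borel_measurable_sum[OF meas]],
          subst nn_integral_sum[OF meas]) (rule refl)
  qed
  also have "\<dots> = (\<Sum>a. ennreal (pmf (binomial_pmf m q) a) *
      ennreal (pmf (msum_pmf (draws_pmf ?D l a) (draws_pmf ?D r (m - a))) A))"
    unfolding * pmf_msum_pmf by (simp add: sum_distrib_left)
  also have "\<dots> = ennreal (pmf (draws_pmf ?D (Node x l r) m) A)"
    by (simp add: ennreal_pmf_bind q_def nn_integral_measure_pmf nn_integral_count_space_nat)
  finally show ?case .
qed

text \<open>Both laws live on a countable type, so singletons suffice; Fubini with the coins outside
  produces \<open>hit\<close>.\<close>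

lemma distr_draws:
  assumes "distinct (pes t)" "1 \<le> v"
  shows "distr (randomness n own w) (count_space UNIV) (\<lambda>\<omega>. draws (fst \<omega>) (snd \<omega>) v t m) =
    measure_pmf (draws_pmf (\<lambda>i. weighted_pmf (local_items n own i) w) t m)"
proof (rule measure_eqI_countable[of _ UNIV])
  fix A :: "nat multiset"
  let ?M = "shared_coins \<Otimes>\<^sub>M local_draws n own w"
  have X: "(\<lambda>\<omega>. draws (fst \<omega>) (snd \<omega>) v t m) \<in> ?M \<rightarrow>\<^sub>M count_space UNIV"
    using measurable_draws[of v t m] by (simp add: case_prod_unfold)
  have "emeasure (distr ?M (count_space UNIV) (\<lambda>\<omega>. draws (fst \<omega>) (snd \<omega>) v t m)) {A} =
      (\<integral>\<^sup>+y. indicator {A} y \<partial>distr ?M (count_space UNIV) (\<lambda>\<omega>. draws (fst \<omega>) (snd \<omega>) v t m))"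
    by simp
  also have "\<dots> = (\<integral>\<^sup>+\<omega>. indicator {A} (draws (fst \<omega>) (snd \<omega>) v t m) \<partial>?M)"
    by (rule nn_integral_distr[OF X]) simp
  also have "\<dots> = (\<integral>\<^sup>+b. hit b v t m A \<partial>shared_coins)"
    unfolding hit_def
    by (subst locals.nn_integral_fst[symmetric])
      (use measurable_indicator_draws in \<open>simp_all add: case_prod_unfold\<close>)
  finally show "emeasure (distr (randomness n own w) (count_space UNIV)
      (\<lambda>\<omega>. draws (fst \<omega>) (snd \<omega>) v t m)) {A} =
    emeasure (measure_pmf (draws_pmf (\<lambda>i. weighted_pmf (local_items n own i) w) t m)) {A}"
    using nn_integral_hit[OF assms] by (simp add: randomness_def emeasure_pmf_single)
qed (simp_all add: countable_multisets)

end

section \<open>Binomial splitting of draws from a mixture\<close>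

definition sample_pmf :: "nat \<Rightarrow> 'a pmf \<Rightarrow> 'a multiset pmf" where
  "sample_pmf m D = map_pmf mset (replicate_pmf m D)"

lemma sample_pmf_0 [simp]: "sample_pmf 0 D = return_pmf {#}"
  by (simp add: sample_pmf_def)

lemma sample_pmf_Suc:
  "sample_pmf (Suc m) D = do {x \<leftarrow> D; S \<leftarrow> sample_pmf m D; return_pmf (add_mset x S)}"
  by (simp add: sample_pmf_def map_bind_pmf bind_map_pmf)

lemma msum_pmf_sample_Suc_left:
  "msum_pmf (sample_pmf (Suc a) P) Q =
     do {x \<leftarrow> P; S \<leftarrow> msum_pmf (sample_pmf a P) Q; return_pmf (add_mset x S)}"
  by (simp add: msum_pmf_def sample_pmf_Suc bind_assoc_pmf bind_return_pmf)

lemma msum_pmf_commute: "msum_pmf P Q = msum_pmf Q P"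
  unfolding msum_pmf_def by (subst bind_commute_pmf) (simp add: add.commute)

lemma msum_pmf_sample_Suc_right:
  "msum_pmf P (sample_pmf (Suc a) Q) =
     do {x \<leftarrow> Q; S \<leftarrow> msum_pmf P (sample_pmf a Q); return_pmf (add_mset x S)}"
  by (subst (1 2) msum_pmf_commute) (rule msum_pmf_sample_Suc_left)

text \<open>One Bernoulli trial of the binomial decides which component supplies one draw. Since
  multisets forget the order, this draw can be split off on either side, and the remaining
  \<open>m\<close> draws form a smaller instance.\<close>

lemma binomial_split:
  assumes q: "q \<in> {0..1}"
  shows "do {a \<leftarrow> binomial_pmf m q; msum_pmf (sample_pmf a P) (sample_pmf (m - a) Q)} =
    sample_pmf m (do {z \<leftarrow> bernoulli_pmf q; if z then P else Q})"
proof (induction m)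
  case 0
  then show ?case
    using q by (simp add: binomial_pmf_0 bind_return_pmf msum_pmf_def)
next
  case (Suc m)
  let ?F = "\<lambda>a. msum_pmf (sample_pmf a P) (sample_pmf (m - a) Q)"
  have "do {a \<leftarrow> binomial_pmf (Suc m) q; msum_pmf (sample_pmf a P) (sample_pmf (Suc m - a) Q)} =
      do {z \<leftarrow> bernoulli_pmf q; a \<leftarrow> binomial_pmf m q;
        msum_pmf (sample_pmf ((if z then 1 else 0) + a) P)
          (sample_pmf (Suc m - ((if z then 1 else 0) + a)) Q)}"
    using q by (simp add: binomial_pmf_Suc bind_assoc_pmf bind_return_pmf)
  also have "\<dots> = do {z \<leftarrow> bernoulli_pmf q; a \<leftarrow> binomial_pmf m q;
      x \<leftarrow> (if z then P else Q); S \<leftarrow> ?F a; return_pmf (add_mset x S)}"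
  proof (intro bind_pmf_cong refl)
    fix z a assume "a \<in> set_pmf (binomial_pmf m q)"
    \<comment> \<open>Needed for \<open>Suc m - a = Suc (m - a)\<close>, so that a draw from
      \<open>Q\<close> can be split off.\<close>
    then have "a \<le> m" using q by (auto simp: set_pmf_binomial_eq split: if_splits)
    then show "msum_pmf (sample_pmf ((if z then 1 else 0) + a) P)
          (sample_pmf (Suc m - ((if z then 1 else 0) + a)) Q) =
        do {x \<leftarrow> (if z then P else Q); S \<leftarrow> ?F a; return_pmf (add_mset x S)}"
      by (cases z) (simp_all add: msum_pmf_sample_Suc_left msum_pmf_sample_Suc_right Suc_diff_le)
  qed
  \<comment> \<open>The new draw does not depend on \<open>a\<close>, so the two are exchanged,
    which exposes the left side of the induction hypothesis.\<close>
  also have "\<dots> = do {z \<leftarrow> bernoulli_pmf q; x \<leftarrow> (if z then P else Q);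
      S \<leftarrow> do {a \<leftarrow> binomial_pmf m q; ?F a}; return_pmf (add_mset x S)}"
    unfolding bind_assoc_pmf
    by (intro bind_pmf_cong[OF refl]) (rule bind_commute_pmf)
  also have "\<dots> = sample_pmf (Suc m) (do {z \<leftarrow> bernoulli_pmf q; if z then P else Q})"
    unfolding Suc.IH sample_pmf_Suc bind_assoc_pmf ..
  finally show ?case .
qed

lemma weighted_pmf_union:
  assumes fin: "finite A" "finite B" and disj: "A \<inter> B = {}"
    and nonneg: "\<And>x. x \<in> A \<union> B \<Longrightarrow> 0 \<le> w x" and pos: "0 < sum w (A \<union> B)"
  shows "weighted_pmf (A \<union> B) w = do {z \<leftarrow> bernoulli_pmf (sum w A / (sum w A + sum w B));
    if z then weighted_pmf A w else weighted_pmf B w}"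
proof (rule pmf_eqI)
  fix x
  define a b where "a = sum w A" and "b = sum w B"
  have ab: "0 \<le> a" "0 \<le> b" "sum w (A \<union> B) = a + b" "0 < a + b"
    using assms by (auto simp: a_def b_def sum.union_disjoint intro!: sum_nonneg)
  \<comment> \<open>Multiplying by \<open>a\<close> makes the formula valid for \<open>a = 0\<close>
    too: there \<open>weighted_pmf A w\<close> is unspecified, but all weights in \<open>A\<close>
    vanish.\<close>
  have A: "a * pmf (weighted_pmf A w) x = (if x \<in> A then w x else 0)"
  proof (cases "a = 0")
    case True
    then have "\<forall>y\<in>A. w y = 0"
      unfolding a_def using fin nonneg by (subst (asm) sum_nonneg_eq_0_iff) auto
    with True show ?thesis by simp
  next
    case False
    then show ?thesis
      using ab fin nonneg unfolding a_def by (subst pmf_weighted_pmf) auto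
  qed
  have B: "b * pmf (weighted_pmf B w) x = (if x \<in> B then w x else 0)"
  proof (cases "b = 0")
    case True
    then have "\<forall>y\<in>B. w y = 0"
      unfolding b_def using fin nonneg by (subst (asm) sum_nonneg_eq_0_iff) auto
    with True show ?thesis by simp
  next
    case False
    then show ?thesis
      using ab fin nonneg unfolding b_def by (subst pmf_weighted_pmf) auto
  qed
  have q: "0 \<le> a / (a + b)" "a / (a + b) \<le> 1" "1 - a / (a + b) = b / (a + b)"
    using ab by (auto simp: field_simps)
  have "pmf (do {z \<leftarrow> bernoulli_pmf (a / (a + b));
      if z then weighted_pmf A w else weighted_pmf B w}) x =
      (a * pmf (weighted_pmf A w) x + b * pmf (weighted_pmf B w) x) / (a + b)"
    using q by (simp add: pmf_bind add_divide_distrib mult.commute)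
  also have "\<dots> = pmf (weighted_pmf (A \<union> B) w) x"
    unfolding A B using fin nonneg pos disj ab by (subst pmf_weighted_pmf) auto
  finally show "pmf (weighted_pmf (A \<union> B) w) x =
      pmf (do {z \<leftarrow> bernoulli_pmf (sum w A / (sum w A + sum w B));
        if z then weighted_pmf A w else weighted_pmf B w}) x"
    by (simp add: a_def b_def)
qed

lemma weight_eq_sum: "stores_weights W t \<Longrightarrow> weight t = (\<Sum>i\<in>set (pes t). W i)"
  by (cases t) auto

text \<open>The last assumption is an invariant handed down to the children: a subtree without
  weight receives no samples, hence an unspecified \<open>weighted_pmf\<close> is never drawn
  from.\<close>

lemma draws_pmf_eq:
  fixes I :: "nat \<Rightarrow> 'a set"
  assumes "distinct (pes t)" "stores_weights (\<lambda>i. sum w (I i)) t"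
    and fin: "\<And>i. finite (I i)" and disj: "\<And>i j. i \<noteq> j \<Longrightarrow> I i \<inter> I j = {}"
    and nonneg: "\<And>i x. x \<in> I i \<Longrightarrow> 0 \<le> w x"
    and "0 < weight t \<or> m = 0"
  shows "draws_pmf (\<lambda>i. weighted_pmf (I i) w) t m =
    sample_pmf m (weighted_pmf (\<Union>i\<in>set (pes t). I i) w)"
  using assms(1,2,6)
proof (induction t arbitrary: m)
  case (Leaf j x)
  then show ?case by (simp add: sample_pmf_def)
next
  case (Node x l r)
  define A B where "A = (\<Union>i\<in>set (pes l). I i)" and "B = (\<Union>i\<in>set (pes r). I i)"
  have lr: "distinct (pes l)" "distinct (pes r)" "set (pes l) \<inter> set (pes r) = {}"
    "stores_weights (\<lambda>i. sum w (I i)) l" "stores_weights (\<lambda>i. sum w (I i)) r"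
    using Node.prems by auto
  have "A \<inter> B = {}"
  proof (rule ccontr)
    assume "A \<inter> B \<noteq> {}"
    then obtain y i j where "y \<in> I i" "i \<in> set (pes l)" "y \<in> I j" "j \<in> set (pes r)"
      unfolding A_def B_def by auto
    then show False using disj[of i j] lr(3) by (cases "i = j") auto
  qed
  then have AB: "finite A" "finite B" "A \<inter> B = {}" "\<And>x. x \<in> A \<union> B \<Longrightarrow> 0 \<le> w x"
    using fin nonneg unfolding A_def B_def by auto
  have l: "weight l = sum w A"
    unfolding A_def weight_eq_sum[OF lr(4)] using fin disj
    by (intro sum.UNION_disjoint[symmetric]) auto
  have r: "weight r = sum w B"
    unfolding B_def weight_eq_sum[OF lr(5)] using fin disj
    by (intro sum.UNION_disjoint[symmetric]) auto
  have x: "weight (Node x l r) = sum w A + sum w B"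
    using Node.prems(1,2) l r weight_eq_sum[OF lr(4)] weight_eq_sum[OF lr(5)]
    by (simp add: sum.union_disjoint)
  have nn: "0 \<le> sum w A" "0 \<le> sum w B" using AB by (auto intro: sum_nonneg)
  let ?q = "weight l / (weight l + weight r)"
  have q: "?q \<in> {0..1}"
    using nn by (auto simp: l r field_simps divide_le_eq_1)
  have "draws_pmf (\<lambda>i. weighted_pmf (I i) w) (Node x l r) m =
    do {a \<leftarrow> binomial_pmf m ?q;
      msum_pmf (sample_pmf a (weighted_pmf A w)) (sample_pmf (m - a) (weighted_pmf B w))}"
    unfolding draws_pmf.simps
  proof (intro bind_pmf_cong refl)
    fix a assume a: "a \<in> set_pmf (binomial_pmf m ?q)"
    then have "a \<le> m"
      using q by (auto simp: set_pmf_binomial_eq split: if_splits)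
    \<comment> \<open>A left child of weight zero gives splitting probability 0, even if both
      weights vanish, as \<open>0 / 0 = 0\<close>.\<close>
    have "0 < weight l \<or> a = 0"
      using a nn by (cases "sum w A = 0") (auto simp: l)
    moreover have "0 < weight r \<or> m - a = 0"
    proof (cases "sum w B = 0 \<and> m \<noteq> 0")
      case True
      \<comment> \<open>The node has positive weight here, all of it on the left, so every sample
        goes left.\<close>
      then have "?q = 1" using Node.prems(3) x by (simp add: l r)
      then show ?thesis using a by simp
    qed (use nn in \<open>auto simp: r\<close>)
    ultimately show "msum_pmf (draws_pmf (\<lambda>i. weighted_pmf (I i) w) l a)
        (draws_pmf (\<lambda>i. weighted_pmf (I i) w) r (m - a)) =
      msum_pmf (sample_pmf a (weighted_pmf A w)) (sample_pmf (m - a) (weighted_pmf B w))"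
      using Node.IH lr by (simp add: A_def B_def)
  qed
  also have "\<dots> = sample_pmf m (do {z \<leftarrow> bernoulli_pmf ?q;
      if z then weighted_pmf A w else weighted_pmf B w})"
    by (rule binomial_split[OF q])
  also have "\<dots> = sample_pmf m (weighted_pmf (A \<union> B) w)"
  proof (cases "m = 0")
    case False
    then have "0 < sum w (A \<union> B)"
      using Node.prems(3) x AB by (simp add: sum.union_disjoint)
    then show ?thesis
      unfolding l r using weighted_pmf_union[OF AB(1-3), of w] AB(4) by simp
  qed simp
  finally show ?case by (simp add: A_def B_def)
qed

section \<open>The tree of residue classes\<close>

text \<open>Bit \<open>d\<close> of \<open>i\<close>, phrased by residues because the subtrees are
  residue classes.\<close>

definition upper :: "nat \<Rightarrow> nat \<Rightarrow> bool" where
  "upper d i \<longleftrightarrow> 2 ^ d \<le> i mod 2 ^ Suc d"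

lemma mod_power_Suc:
  "(i :: nat) mod 2 ^ Suc d = (if upper d i then i mod 2 ^ d + 2 ^ d else i mod 2 ^ d)"
proof -
  have *: "i mod 2 ^ Suc d = 2 ^ d * (i div 2 ^ d mod 2) + i mod 2 ^ d"
    by (simp add: mod_mult2_eq power_Suc2 del: power_Suc)
  define b where "b = i div 2 ^ d mod 2"
  have "i div 2 ^ d mod 2 = 0 \<or> i div 2 ^ d mod 2 = 1" by auto
  then have b: "i div 2 ^ d mod 2 = b" "b = 0 \<or> b = 1" by (simp_all only: b_def)
  have "i mod 2 ^ d < 2 ^ d" by simp
  with b(2) show ?thesis unfolding upper_def * b(1) by (elim disjE) (simp_all add: not_le)
qed

text \<open>Clearing bit \<open>d\<close> leads to the butterfly partner, which lies in the sibling
  class modulo \<open>2 ^ Suc d\<close>.\<close>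

lemma upper_diff:
  assumes "upper d i"
  shows "2 ^ d \<le> i" "\<not> upper d (i - 2 ^ d)" "(i - 2 ^ d) mod 2 ^ Suc d = i mod 2 ^ d"
proof -
  let ?r = "i mod 2 ^ Suc d"
  have r: "2 ^ d \<le> ?r" "?r < 2 ^ Suc d" "?r \<le> i"
    using assms by (auto simp: upper_def)
  then show "2 ^ d \<le> i" by linarith
  have "i - 2 ^ d = (?r - 2 ^ d) + 2 ^ Suc d * (i div 2 ^ Suc d)"
    using r mult_div_mod_eq[of "2 ^ Suc d" i] by linarith
  then have "(i - 2 ^ d) mod 2 ^ Suc d = (?r - 2 ^ d) mod 2 ^ Suc d"
    by (metis mod_mult_self2)
  also have "\<dots> = ?r - 2 ^ d"
    using r by (intro mod_less) linarith
  finally have *: "(i - 2 ^ d) mod 2 ^ Suc d = ?r - 2 ^ d" .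
  then show "(i - 2 ^ d) mod 2 ^ Suc d = i mod 2 ^ d"
    using assms mod_power_Suc[of i d] by simp
  show "\<not> upper d (i - 2 ^ d)"
    unfolding upper_def * using r unfolding power_Suc by linarith
qed

lemma not_upper_add:
  assumes "\<not> upper d i"
  shows "upper d (i + 2 ^ d)" "(i + 2 ^ d) mod 2 ^ Suc d = i mod 2 ^ d + 2 ^ d"
proof -
  have r: "i mod 2 ^ Suc d = i mod 2 ^ d" "i mod 2 ^ Suc d < 2 ^ d"
    using assms mod_power_Suc[of i d] by (auto simp: upper_def)
  have "(i + 2 ^ d) mod 2 ^ Suc d = (i mod 2 ^ Suc d + 2 ^ d) mod 2 ^ Suc d"
    by (simp only: mod_add_left_eq)
  also have "\<dots> = i mod 2 ^ Suc d + 2 ^ d"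
    using r(2) by (intro mod_less) simp
  finally show *: "(i + 2 ^ d) mod 2 ^ Suc d = i mod 2 ^ d + 2 ^ d"
    by (simp only: r(1))
  show "upper d (i + 2 ^ d)"
    unfolding upper_def * by simp
qed

text \<open>Setting one of the lowest \<open>h\<close> bits cannot leave the \<open>h\<close>-bit
  numbers. Hence every butterfly partner exists although \<open>p\<close> need not be a power of
  two.\<close>

lemma not_upper_add_less:
  assumes "\<not> upper d i" "i < 2 ^ h" "d < h"
  shows "i + 2 ^ d < 2 ^ h"
proof -
  obtain k where h: "h = Suc d + k" using \<open>d < h\<close> by (metis less_iff_Suc_add add_Suc)
  let ?a = "i div 2 ^ Suc d"
  have i: "i = 2 ^ Suc d * ?a + i mod 2 ^ Suc d" by simp
  have "?a < 2 ^ k"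
    by (rule less_mult_imp_div_less) (use assms(2) in \<open>simp add: h power_add ac_simps\<close>)
  then have "2 ^ Suc d * (?a + 1) \<le> (2 :: nat) ^ h"
    unfolding h power_add by (intro mult_le_mono2) simp
  moreover have "i mod 2 ^ Suc d < 2 ^ d" using assms(1) by (simp add: upper_def)
  ultimately show ?thesis using i by (simp add: algebra_simps)
qed

lemma mod_power_mod: "e \<le> d \<Longrightarrow> (i :: nat) mod 2 ^ d mod 2 ^ e = i mod 2 ^ e"
  by (simp add: mod_mod_cancel le_imp_power_dvd)

definition residue_pes :: "nat \<Rightarrow> nat \<Rightarrow> nat \<Rightarrow> nat set" where
  "residue_pes p d c = {j. j < p \<and> j mod 2 ^ d = c mod 2 ^ d}"

definition residue_weight :: "nat \<Rightarrow> (nat \<Rightarrow> real) \<Rightarrow> nat \<Rightarrow> nat \<Rightarrow> real" where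
  "residue_weight p W d c = sum W (residue_pes p d c)"

lemma finite_residue_pes: "finite (residue_pes p d c)"
  by (simp add: residue_pes_def)

lemma residue_weight_cong: "c mod 2 ^ d = c' mod 2 ^ d \<Longrightarrow> residue_weight p W d c = residue_weight p W d c'"
  by (simp add: residue_weight_def residue_pes_def)

lemma residue_pes_split:
  assumes "c < 2 ^ d"
  shows "residue_pes p d c = residue_pes p (Suc d) c \<union> residue_pes p (Suc d) (c + 2 ^ d)"
    and "residue_pes p (Suc d) c \<inter> residue_pes p (Suc d) (c + 2 ^ d) = {}"
proof -
  have c: "c mod 2 ^ d = c" "c mod 2 ^ Suc d = c" "(c + 2 ^ d) mod 2 ^ Suc d = c + 2 ^ d"
    using assms by simp_all
  have j: "j mod 2 ^ d = c \<longleftrightarrow> j mod 2 ^ Suc d = c \<or> j mod 2 ^ Suc d = c + 2 ^ d" for j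
  proof -
    have "j mod 2 ^ d < 2 ^ d" by simp
    then show ?thesis
      using assms mod_power_Suc[of j d] by (cases "upper d j") (simp_all only: if_True if_False, arith+)
  qed
  show "residue_pes p d c = residue_pes p (Suc d) c \<union> residue_pes p (Suc d) (c + 2 ^ d)"
    unfolding residue_pes_def c j by blast
  show "residue_pes p (Suc d) c \<inter> residue_pes p (Suc d) (c + 2 ^ d) = {}"
    unfolding residue_pes_def c by auto
qed

lemma residue_weight_split:
  "residue_weight p W d i =
     residue_weight p W (Suc d) (i mod 2 ^ d) + residue_weight p W (Suc d) (i mod 2 ^ d + 2 ^ d)"
proof -
  have "residue_weight p W d i = residue_weight p W d (i mod 2 ^ d)"
    by (rule residue_weight_cong) simp
  then show ?thesis
    unfolding residue_weight_def using residue_pes_split[of "i mod 2 ^ d" d p]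
    by (simp add: sum.union_disjoint finite_residue_pes)
qed

text \<open>A class starts at its residue and has spacing \<open>2 ^ d\<close>. If the second member
  is out of range, only the residue itself is left.\<close>

lemma residue_pes_singleton:
  assumes "i < p" "p \<le> i mod 2 ^ d + 2 ^ d"
  shows "residue_pes p d i = {i}"
proof -
  have "j = i" if "j < p" "j mod 2 ^ d = i mod 2 ^ d" for j
  proof -
    have "k div 2 ^ d = 0" if "k < p" "k mod 2 ^ d = i mod 2 ^ d" for k
    proof (rule ccontr)
      assume "k div 2 ^ d \<noteq> 0"
      then have "2 ^ d \<le> 2 ^ d * (k div 2 ^ d)" by simp
      then show False using mult_div_mod_eq[of "2 ^ d" k] that assms(2) by linarith
    qed
    from this[OF that] this[OF assms(1) refl] show ?thesis
      using mult_div_mod_eq[of "2 ^ d" i] mult_div_mod_eq[of "2 ^ d" j] that(2) by simp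
  qed
  then show ?thesis using assms(1) by (auto simp: residue_pes_def)
qed

text \<open>The subtree at depth \<open>d\<close> for the residue \<open>c\<close> contains the PEs congruent to \<open>c\<close>
  modulo \<open>2 ^ d\<close>. Splitting by the lowest bit first lets a butterfly exchange that processes the
  bits from the highest to the lowest produce the paths from the leaves to the root.\<close>

function residue_tree :: "nat \<Rightarrow> (nat \<Rightarrow> real) \<Rightarrow> nat \<Rightarrow> nat \<Rightarrow> dctree" where
  "residue_tree p W d c =
     (if c + 2 ^ d < p
      then Node (residue_weight p W d c) (residue_tree p W (Suc d) c) (residue_tree p W (Suc d) (c + 2 ^ d))
      else Leaf c (W c))"
  by auto
termination
proof (relation "Wellfounded.measure (\<lambda>(p, W, d, c). p - 2 ^ d)")
  fix p d c :: nat
  assume "c + 2 ^ d < p"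
  moreover have "(1 :: nat) \<le> 2 ^ d" by simp
  \<comment> \<open>The guard implies \<open>2 ^ d < p\<close>, so the truncated difference is
    positive and decreases when the power doubles.\<close>
  ultimately have "p - 2 ^ Suc d < p - 2 ^ d" unfolding power_Suc by linarith
  then show "((p, W, Suc d, c), p, W, d, c) \<in> Wellfounded.measure (\<lambda>(p, W, d, c). p - 2 ^ d)"
    "((p, W, Suc d, c + 2 ^ d), p, W, d, c) \<in> Wellfounded.measure (\<lambda>(p, W, d, c). p - 2 ^ d)"
    for W :: "nat \<Rightarrow> real"
    by simp_all
qed simp

declare residue_tree.simps [simp del]

lemma residue_tree_props:
  assumes "c < 2 ^ d" "c < p"
  shows "distinct (pes (residue_tree p W d c)) \<and>
    set (pes (residue_tree p W d c)) = residue_pes p d c \<and>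
    stores_weights W (residue_tree p W d c)"
  using assms
proof (induction p W d c rule: residue_tree.induct)
  case (1 p W d c)
  show ?case
  proof (cases "c + 2 ^ d < p")
    case True
    note IH = 1(1)[OF True] 1(2)[OF True]
    show ?thesis
      using IH 1(3,4) True residue_pes_split[OF 1(3), of p]
      by (subst (1 2 3) residue_tree.simps) (simp add: residue_weight_def)
  next
    case False
    then show ?thesis
      using residue_pes_singleton[of c p d] 1(3,4) by (simp add: residue_tree.simps)
  qed
qed

lemma is_dctree_residue_tree:
  assumes "1 \<le> p" shows "is_dctree p W (residue_tree p W 0 0)"
  using residue_tree_props[of 0 0 p W] assms by (auto simp: is_dctree_def residue_pes_def)

lemma weight_residue_tree:
  assumes "c < 2 ^ d" "c < p"
  shows "weight (residue_tree p W d c) = residue_weight p W d c"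
  using residue_tree_props[OF assms, of W] weight_eq_sum[of W "residue_tree p W d c"]
  by (simp add: residue_weight_def)

text \<open>Closed form of the entry for the ancestor at depth \<open>d\<close>, so that the
  butterfly can be checked round by round without unfolding the tree.\<close>

definition path_entry :: "nat \<Rightarrow> (nat \<Rightarrow> real) \<Rightarrow> nat \<Rightarrow> nat \<Rightarrow> real \<times> real \<times> real" where
  "path_entry p W i d = (residue_weight p W (Suc d) (i mod 2 ^ d),
     residue_weight p W (Suc d) (i mod 2 ^ d + 2 ^ d), of_bool (upper d i))"

lemma path_entry_cong:
  "i mod 2 ^ Suc d = j mod 2 ^ Suc d \<Longrightarrow> path_entry p W i d = path_entry p W j d"
  using mod_power_mod[of d "Suc d" i] mod_power_mod[of d "Suc d" j]
  by (simp add: path_entry_def upper_def)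

text \<open>Depth of the leaf of PE \<open>i\<close> if \<open>2 ^ h \<le> p < 2 ^ Suc h\<close>: it
  is \<open>Suc h\<close> exactly if the class of \<open>i\<close> modulo \<open>2 ^ h\<close> has
  two members.\<close>

definition path_length :: "nat \<Rightarrow> nat \<Rightarrow> nat \<Rightarrow> nat" where
  "path_length p h i = (if i mod 2 ^ h + 2 ^ h < p then Suc h else h)"

text \<open>The left side is the splitting test of \<open>residue_tree\<close>. For
  \<open>d < h\<close> the sum is below \<open>2 ^ Suc d \<le> 2 ^ h\<close>, for
  \<open>h < d\<close> the power alone exceeds \<open>p\<close>, and \<open>d = h\<close> is the
  definition.\<close>

lemma less_path_length:
  assumes "2 ^ h \<le> p" "p < 2 ^ Suc h"
  shows "i mod 2 ^ d + 2 ^ d < p \<longleftrightarrow> d < path_length p h i"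
proof (rule linorder_cases[of d h])
  assume "d < h"
  then have "2 ^ Suc d \<le> (2 :: nat) ^ h" by (intro power_increasing) auto
  moreover have "i mod 2 ^ d < 2 ^ d" by simp
  ultimately have "i mod 2 ^ d + 2 ^ d < p" using assms(1) unfolding power_Suc by linarith
  then show ?thesis using \<open>d < h\<close> by (simp add: path_length_def)
next
  assume "h < d"
  then have "2 ^ Suc h \<le> (2 :: nat) ^ d" by (intro power_increasing) auto
  then show ?thesis using \<open>h < d\<close> assms by (simp add: path_length_def)
qed (simp add: path_length_def)

text \<open>Induction on the remaining depth: at depth \<open>d\<close> the path goes left exactly
  if bit \<open>d\<close> of the rank is clear.\<close>

lemma pe_path_residue_tree:
  assumes p: "2 ^ h \<le> p" "p < 2 ^ Suc h" and "i < p" "d \<le> path_length p h i"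
  shows "pe_path i (residue_tree p W d (i mod 2 ^ d)) =
    map (path_entry p W i) [d..<path_length p h i]"
  using assms(4)
proof (induction "path_length p h i - d" arbitrary: d)
  case 0
  then show ?case
    using less_path_length[OF p, of i d] by (simp add: residue_tree.simps)
next
  case (Suc n)
  then have d: "d < path_length p h i" by simp
  define c where "c = i mod 2 ^ d"
  have cp: "c + 2 ^ d < p" using less_path_length[OF p, of i d] d by (simp add: c_def)
  have c: "c < 2 ^ d" by (simp add: c_def)
  then have c': "c < 2 ^ Suc d" "c + 2 ^ d < 2 ^ Suc d" by simp_all
  have l: "i \<in> set (pes (residue_tree p W (Suc d) c)) \<longleftrightarrow> \<not> upper d i"
    using residue_tree_props[of c "Suc d" p W] cp c' \<open>i < p\<close> mod_power_Suc[of i d]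
    by (auto simp: residue_pes_def c_def)
  have IH: "pe_path i (residue_tree p W (Suc d) (i mod 2 ^ Suc d)) =
      map (path_entry p W i) [Suc d..<path_length p h i]"
    using Suc.hyps(2) d by (intro Suc.hyps(1)) auto
  have "pe_path i (residue_tree p W d c) =
      path_entry p W i d # pe_path i (residue_tree p W (Suc d) (i mod 2 ^ Suc d))"
    using cp c' weight_residue_tree[of c "Suc d" p W] weight_residue_tree[of "c + 2 ^ d" "Suc d" p W]
    by (subst residue_tree.simps)
      (simp add: l path_entry_def mod_power_Suc[of i d] c_def[symmetric] del: power_Suc)
  also have "\<dots> = map (path_entry p W i) [d..<path_length p h i]"
    unfolding IH using d by (simp add: upt_conv_Cons)
  finally show ?case unfolding c_def .
qed

lemma pe_path_root:
  assumes "2 ^ h \<le> p" "p < 2 ^ Suc h" and "i < p"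
  shows "pe_path i (residue_tree p W 0 0) = map (path_entry p W i) [0..<path_length p h i]"
  using pe_path_residue_tree[OF assms, of 0 W] by simp

section \<open>Runs without communication and the sampling program\<close>

lemma idx_of_nat: "x = real n \<Longrightarrow> idx x = n"
  by (simp add: idx_def)

text \<open>Negative reals become 0, just as subtraction on naturals truncates. Thus the program
  agrees with \<open>share\<close> even for a deviate larger than the number of trials.\<close>

lemma idx_diff: "idx (x - real c) = idx x - c"
proof -
  have "\<lfloor>x - real c\<rfloor> = \<lfloor>x\<rfloor> - int c"
    by (metis floor_diff_of_int of_int_of_nat_eq)
  then show ?thesis by (simp add: idx_def nat_diff_distrib')
qed

fun is_local :: "instr \<Rightarrow> bool" where
  "is_local (Send j a l) = False"
| "is_local (Recv j a) = False"
| "is_local _ = True"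

lemma local_sends_receives:
  "is_local (P ! pc x) \<Longrightarrow> sends P x = None \<and> receives P x = None"
  by (cases "P ! pc x") (auto simp: sends_def receives_def)

text \<open>A run of a single PE that never offers a message. Whether it sits at a receive does not
  matter, since a message can only be delivered when some other PE offers one.\<close>

fun runs :: "env \<Rightarrow> instr list \<Rightarrow> nat \<Rightarrow> nat \<Rightarrow> pe_state \<Rightarrow> pe_state \<Rightarrow> bool" where
  "runs E P i 0 x y \<longleftrightarrow> x = y"
| "runs E P i (Suc N) x y \<longleftrightarrow> sends P x = None \<and>
     runs E P i N (if halted P x \<or> receives P x \<noteq> None then x else exec E i (P ! pc x) x) y"

lemma runs_local:
  assumes "pc x < length P" "is_local (P ! pc x)"
  shows "runs E P i (numeral k) x y \<longleftrightarrow> runs E P i (pred_numeral k) (exec E i (P ! pc x) x) y"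
    and "runs E P i (Suc N) x y \<longleftrightarrow> runs E P i N (exec E i (P ! pc x) x) y"
    and "runs E P i 1 x y \<longleftrightarrow> exec E i (P ! pc x) x = y"
  using assms local_sends_receives[OF assms(2)] by (auto simp: numeral_eq_Suc halted_def)

text \<open>A halted or receiving PE has runs of every length, which lets all PEs be run for a
  common number of steps.\<close>

lemma runs_wait:
  assumes "halted P x \<or> receives P x \<noteq> None"
  shows "runs E P i N x y \<longleftrightarrow> x = y"
proof -
  have "sends P x = None"
    using assms by (auto simp: sends_def receives_def split: instr.splits)
  with assms show ?thesis by (induction N) auto
qed

lemma runs_add: "runs E P i N x y \<Longrightarrow> runs E P i M y z \<Longrightarrow> runs E P i (N + M) x z"
  by (induction N arbitrary: x) auto

text \<open>If nobody offers a message, nothing is delivered and \<open>machine_step\<close> acts on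
  each PE separately.\<close>

lemma runs_parallel:
  assumes "\<And>i. i < npes E \<Longrightarrow> runs E P i N (s i) (s' i)"
  shows "(machine_step E P ^^ N) s = (\<lambda>i. if i < npes E then s' i else s i)"
  using assms
proof (induction N arbitrary: s)
  case (Suc N)
  let ?next = "\<lambda>x i. if halted P x \<or> receives P x \<noteq> None then x else exec E i (P ! pc x) x"
  have quiet: "sends P (s i) = None" if "i < npes E" for i
    using Suc.prems[OF that] by simp
  have step: "machine_step E P s = (\<lambda>i. if i < npes E then ?next (s i) i else s i)"
    by (auto simp: fun_eq_iff machine_step_def Let_def quiet split: option.split)
  have "(machine_step E P ^^ Suc N) s = (machine_step E P ^^ N) (machine_step E P s)"
    by (simp only: funpow_Suc_right o_apply)
  also have "\<dots> = (\<lambda>i. if i < npes E then s' i else machine_step E P s i)"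
    by (rule Suc.IH) (use Suc.prems in \<open>simp add: step\<close>)
  finally show ?case by (simp add: step fun_eq_iff)
qed auto

declare runs.simps(2) [simp del]

lemma machine_step_all_halted: "all_halted E P s \<Longrightarrow> (machine_step E P ^^ N) s = s"
proof (induction N)
  case (Suc N)
  then show ?case
    by (auto simp: machine_step_def Let_def all_halted_def fun_eq_iff)
qed simp

text \<open>A halted machine no longer changes, so every late enough step count gives the state at
  the least one.\<close>

lemma terminates_final:
  assumes "all_halted E P ((machine_step E P ^^ T) s)"
  shows "terminates E P s" "final E P s = (machine_step E P ^^ T) s"
proof -
  let ?h = "\<lambda>t. all_halted E P ((machine_step E P ^^ t) s)"
  show "terminates E P s" using assms by (auto simp: terminates_def)
  have least: "?h (LEAST t. ?h t)" "(LEAST t. ?h t) \<le> T"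
    using assms by (auto intro: LeastI Least_le)
  then have "(machine_step E P ^^ T) s =
      (machine_step E P ^^ (T - (LEAST t. ?h t))) ((machine_step E P ^^ (LEAST t. ?h t)) s)"
    by (simp add: funpow_add[symmetric, THEN fun_cong, unfolded o_apply])
  also have "\<dots> = final E P s"
    unfolding final_def by (rule machine_step_all_halted[OF least(1)])
  finally show "final E P s = (machine_step E P ^^ T) s" by simp
qed

lemma terminates_independent:
  assumes "\<And>i. i < npes E \<Longrightarrow> \<exists>N y. runs E P i N (s i) y \<and> halted P y \<and> Q i y"
  shows "terminates E P s \<and> (\<forall>i < npes E. Q i (final E P s i))"
proof -
  obtain N y where Ny: "\<And>i. i < npes E \<Longrightarrow> runs E P i (N i) (s i) (y i) \<and> halted P (y i) \<and> Q i (y i)"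
    using assms by metis
  \<comment> \<open>Any common bound on the running times would do; shorter runs idle after
    halting.\<close>
  define T where "T = (\<Sum>i<npes E. N i)"
  have "runs E P i T (s i) (y i)" if "i < npes E" for i
  proof -
    have "N i \<le> T"
      unfolding T_def using that by (intro member_le_sum) auto
    then obtain M where "T = N i + M" using le_Suc_ex by blast
    then show ?thesis
      using Ny[OF that] by (auto intro!: runs_add simp: runs_wait)
  qed
  then have T: "(machine_step E P ^^ T) s = (\<lambda>i. if i < npes E then y i else s i)"
    by (rule runs_parallel)
  have "all_halted E P ((machine_step E P ^^ T) s)"
    using Ny by (simp add: T all_halted_def)
  from terminates_final[OF this] show ?thesis using Ny by (simp add: T)
qed

text \<open>Register 2 holds the number of samples at the current node, 5 the read address, 6 the node ID
  and 7 the depth. The branch taken is computed arithmetically: with the direction bit in register 10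
  and the deviate \<open>b\<close> in register 11, \<open>m\<close> becomes \<open>b + bit * (m - 2 * b)\<close>.\<close>

definition sampling_prog :: "instr list" where
  "sampling_prog = [Const 4 1, Const 5 0, Const 6 1, Const 7 0, JumpLeq 3 7 22,
    Load 8 5, Arith Add 5 5 4, Load 9 5, Arith Add 5 5 4, Load 10 5,
    Arith Add 5 5 4, Arith Add 9 8 9, Arith Div 9 8 9, Binom 11 6 2 9, Arith Sub 2 2 11,
    Arith Sub 2 2 11, Arith Mul 2 2 10, Arith Add 2 2 11, Arith Add 6 6 6, Arith Add 6 6 10,
    Arith Add 7 7 4, JumpLeq 4 4 4, Sample 2]"

lemma length_sampling_prog: "length sampling_prog = 23"
  by (simp add: sampling_prog_def)

lemma sampling_prog_nth:
  "sampling_prog ! 0 = Const 4 1" "sampling_prog ! Suc 0 = Const 5 0"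
  "sampling_prog ! 2 = Const 6 1" "sampling_prog ! 3 = Const 7 0"
  "sampling_prog ! 4 = JumpLeq 3 7 22" "sampling_prog ! 5 = Load 8 5"
  "sampling_prog ! 6 = Arith Add 5 5 4" "sampling_prog ! 7 = Load 9 5"
  "sampling_prog ! 8 = Arith Add 5 5 4" "sampling_prog ! 9 = Load 10 5"
  "sampling_prog ! 10 = Arith Add 5 5 4" "sampling_prog ! 11 = Arith Add 9 8 9"
  "sampling_prog ! 12 = Arith Div 9 8 9" "sampling_prog ! 13 = Binom 11 6 2 9"
  "sampling_prog ! 14 = Arith Sub 2 2 11" "sampling_prog ! 15 = Arith Sub 2 2 11"
  "sampling_prog ! 16 = Arith Mul 2 2 10" "sampling_prog ! 17 = Arith Add 2 2 11"
  "sampling_prog ! 18 = Arith Add 6 6 6" "sampling_prog ! 19 = Arith Add 6 6 10"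
  "sampling_prog ! 20 = Arith Add 7 7 4" "sampling_prog ! 21 = JumpLeq 4 4 4"
  "sampling_prog ! 22 = Sample 2"
  by (simp_all add: sampling_prog_def)

lemmas state_simps = set_reg_def tick_def Let_def

text \<open>Invariant at the node with ID \<open>v\<close> and depth \<open>d\<close>. Register 2
  enters only through \<open>idx\<close> because it may become negative. The loop has 18
  instructions; the final 2 are the exit jump and \<open>Sample\<close>.\<close>

lemma sampling_loop:
  assumes "pc x = 4" "reg x 4 = 1" "reg x 5 = 3 * real d" "reg x 6 = real v" "reg x 7 = real d"
    and "reg x 3 = real (d + length (pe_path i t))"
    and "\<And>e. e < length (pe_path i t) \<Longrightarrow>
      (mem x (3 * (d + e)), mem x (3 * (d + e) + 1), mem x (3 * (d + e) + 2)) = pe_path i t ! e"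
  shows "\<exists>N y. runs E sampling_prog i N x y \<and> halted sampling_prog y \<and>
    samples y = samples x @ loc E (i, share (coin E) v t (idx (reg x 2)) i) \<and>
    clock y = clock x + 18 * real (length (pe_path i t)) + 2 +
      loc_time E i (share (coin E) v t (idx (reg x 2)) i)"
  using assms
proof (induction t arbitrary: x d v)
  case (Leaf j z)
  then have "\<exists>y. runs E sampling_prog i 2 x y \<and> halted sampling_prog y \<and>
    samples y = samples x @ loc E (i, share (coin E) v (Leaf j z) (idx (reg x 2)) i) \<and>
    clock y = clock x + 18 * real (length (pe_path i (Leaf j z))) + 2 +
      loc_time E i (share (coin E) v (Leaf j z) (idx (reg x 2)) i)"
    by (simp add: runs_local length_sampling_prog sampling_prog_nth state_simps halted_def)
  then show ?case by blast
next
  case (Node z l r)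
  define L R where "L = weight l" and "R = weight r"
  define left where "left \<longleftrightarrow> i \<in> set (pes l)"
  \<comment> \<open>Both directions execute the same instructions, so one symbolic execution with
    the bit \<open>turn\<close> covers them.\<close>
  define turn where "turn = (if left then 0 else 1 :: real)"
  define u where "u = (if left then l else r)"
  have path: "pe_path i (Node z l r) = (L, R, turn) # pe_path i u"
    by (simp add: L_def R_def left_def u_def turn_def)
  have idx: "idx (3 * real d) = 3 * d" "idx (3 * real d + 1) = Suc (3 * d)"
    "idx (2 + 3 * real d) = Suc (Suc (3 * d))" "idx (real v) = v"
    by (auto intro!: idx_of_nat)
  have mem: "mem x (3 * d) = L" "mem x (Suc (3 * d)) = R"
    "mem x (Suc (Suc (3 * d))) = turn"
    using Node.prems(7)[of 0, unfolded path] by simp_all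
  define c where "c = coin E (v, idx (reg x 2), L / (L + R))"
  define v' where "v' = (if left then 2 * v else 2 * v + 1)"
  have v': "real v + real v + turn = real v'" "real v * 2 + turn = real v'" "2 * real v + turn = real v'"
    by (simp_all add: v'_def turn_def)
  have r3: "reg x 3 = 1 + (real d + real (length (pe_path i u)))"
    using Node.prems(6)[unfolded path] by simp
  have "\<exists>y. runs E sampling_prog i 18 x y \<and> pc y = 4 \<and> reg y 4 = 1 \<and>
      reg y 5 = 3 * real (Suc d) \<and> reg y 6 = real v' \<and> reg y 7 = real (Suc d) \<and>
      reg y 3 = reg x 3 \<and> mem y = mem x \<and> samples y = samples x \<and> clock y = clock x + 18 \<and>
      reg y 2 = (reg x 2 - real c - real c) * turn + real c"
    using Node.prems(1-5) r3
    by (simp add: runs_local length_sampling_prog sampling_prog_nth state_simps idx mem c_def v')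
  then obtain y where y: "runs E sampling_prog i 18 x y" "pc y = 4" "reg y 4 = 1"
      "reg y 5 = 3 * real (Suc d)" "reg y 6 = real v'" "reg y 7 = real (Suc d)"
      "reg y 3 = reg x 3" "mem y = mem x" "samples y = samples x" "clock y = clock x + 18"
      "reg y 2 = (reg x 2 - real c - real c) * turn + real c"
    by blast
  then have y2: "reg y 2 = (if left then real c else reg x 2 - real c)"
    by (simp add: turn_def)
  have share: "share (coin E) v (Node z l r) (idx (reg x 2)) i =
      share (coin E) v' u (idx (reg y 2)) i"
    by (simp add: y2 v'_def u_def left_def c_def L_def R_def idx_diff idx_of_nat Let_def)
  have "\<exists>N y'. runs E sampling_prog i N y y' \<and> halted sampling_prog y' \<and>
    samples y' = samples y @ loc E (i, share (coin E) v' u (idx (reg y 2)) i) \<and>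
    clock y' = clock y + 18 * real (length (pe_path i u)) + 2 +
      loc_time E i (share (coin E) v' u (idx (reg y 2)) i)"
  proof -
    have r3: "reg y 3 = real (Suc d + length (pe_path i u))"
      using Node.prems(6)[unfolded path] by (simp add: y(7))
    have m: "(mem y (3 * (Suc d + e)), mem y (3 * (Suc d + e) + 1), mem y (3 * (Suc d + e) + 2)) =
        pe_path i u ! e" if "e < length (pe_path i u)" for e
      using Node.prems(7)[of "Suc e", unfolded path] that by (simp add: y(8))
    show ?thesis
    proof (cases left)
      case True
      then have "u = l" by (simp add: u_def)
      show ?thesis
        using Node.IH(1)[OF y(2-6) r3[unfolded \<open>u = l\<close>] m[unfolded \<open>u = l\<close>]]
        by (simp add: \<open>u = l\<close>)
    next
      case False
      then have "u = r" by (simp add: u_def)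
      show ?thesis
        using Node.IH(2)[OF y(2-6) r3[unfolded \<open>u = r\<close>] m[unfolded \<open>u = r\<close>]]
        by (simp add: \<open>u = r\<close>)
    qed
  qed
  then obtain N y' where "runs E sampling_prog i N y y'" "halted sampling_prog y'"
    "samples y' = samples y @ loc E (i, share (coin E) v' u (idx (reg y 2)) i)"
    "clock y' = clock y + 18 * real (length (pe_path i u)) + 2 +
      loc_time E i (share (coin E) v' u (idx (reg y 2)) i)" by blast
  then show ?case
    using runs_add[OF y(1)] unfolding share path by (auto simp: y(9,10) algebra_simps)
qed

lemma sampling_correct:
  assumes "sample_start (npes E) t k s"
  shows "terminates E sampling_prog s \<and> (\<forall>i < npes E.
    samples (final E sampling_prog s i) = loc E (i, share (coin E) 1 t k i) \<and>
    clock (final E sampling_prog s i) = 18 * real (length (pe_path i t)) + 6 +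
      loc_time E i (share (coin E) 1 t k i))"
proof (rule terminates_independent)
  fix i assume "i < npes E"
  then have x: "pc (s i) = 0" "clock (s i) = 0" "samples (s i) = []" "reg (s i) 2 = real k"
    "holds_path t i (s i)"
    using assms by (auto simp: sample_start_def ready_def)
  have "\<exists>y. runs E sampling_prog i 4 (s i) y \<and> pc y = 4 \<and> reg y 4 = 1 \<and> reg y 5 = 3 * real 0 \<and>
      reg y 6 = real 1 \<and> reg y 7 = real 0 \<and> reg y 3 = reg (s i) 3 \<and> mem y = mem (s i) \<and>
      samples y = [] \<and> clock y = 4 \<and> reg y 2 = real k"
    using x(1-4)
    by (simp add: runs_local length_sampling_prog sampling_prog_nth state_simps
      numeral_2_eq_2[symmetric])
  then obtain y where y: "runs E sampling_prog i 4 (s i) y" "pc y = 4" "reg y 4 = 1"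
    "reg y 5 = 3 * real 0" "reg y 6 = real 1" "reg y 7 = real 0" "reg y 3 = reg (s i) 3"
    "mem y = mem (s i)" "samples y = []" "clock y = 4" "reg y 2 = real k" by blast
  obtain N z where "runs E sampling_prog i N y z" "halted sampling_prog z"
    "samples z = samples y @ loc E (i, share (coin E) 1 t (idx (reg y 2)) i)"
    "clock z = clock y + 18 * real (length (pe_path i t)) + 2 +
      loc_time E i (share (coin E) 1 t (idx (reg y 2)) i)"
    using sampling_loop[OF y(2-6), of i t E] x(5) by (auto simp: y(7,8) holds_path_def)
  then show "\<exists>N z. runs E sampling_prog i N (s i) z \<and> halted sampling_prog z \<and>
      samples z = loc E (i, share (coin E) 1 t k i) \<and>
      clock z = 18 * real (length (pe_path i t)) + 6 + loc_time E i (share (coin E) 1 t k i)"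
    using runs_add[OF y(1)] by (intro exI[of _ "4 + N"] exI[of _ z]) (simp add: y(9-11) idx_of_nat)
qed

section \<open>The tree-building program\<close>

text \<open>Positions 8 to 14 compute \<open>h\<close> (register 3) and \<open>2 ^ h\<close> (register 5) by doubling. Positions 18
  to 44 are the exchange of the sibling leaves, with separate code for the PEs with a partner \<open>2 ^ h\<close>
  above (21 to 28) or below (29 to 36) them and for those without one (37 to 44, idling for as many
  steps). Positions 45 to 68 are a butterfly round, with separate code for a clear (51 to 57) and a
  set bit (58 to 64). Register 2 accumulates the weight of the current subtree, 7 is the address of
  the current path entry, 5 the current power of two, 9 the rank reduced modulo it, and 11 the partner
  in the leaf exchange.\<close>

definition build_prog :: "instr list" where
  "build_prog = [Const 4 1, Const 5 1, Const 7 0, Const 8 3, Const 3 0,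
    Const 10 0, Const 17 2, Arith Add 9 0 10, Arith Add 6 5 5, JumpLeq 6 1 11,
    JumpLeq 4 4 15, Arith Add 5 5 5, Arith Add 7 7 8, Arith Add 3 3 4, JumpLeq 4 4 8,
    Arith Add 12 7 4, Arith Add 13 12 4, Arith Add 19 7 10, JumpLeq 5 0 29, Arith Add 11 0 5,
    JumpLeq 1 11 37, Store 7 2, Store 13 10, Recv 11 12, Send 11 7 4,
    Load 14 12, Arith Add 2 2 14, Arith Add 3 3 4, JumpLeq 4 4 45, Arith Sub 11 0 5,
    Store 12 2, Store 13 4, Arith Add 3 3 4, Send 11 12 4, Recv 11 7,
    Recv 11 10, JumpLeq 4 4 71, Const 18 0, Const 18 0, Const 18 0,
    Const 18 0, Const 18 0, Const 18 0, Const 18 0, Const 18 0,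
    JumpLeq 7 10 69, Arith Sub 7 7 8, Arith Div 5 5 17, Arith Add 12 7 4, Arith Add 13 12 4,
    JumpLeq 5 9 58, Arith Add 16 0 5, Store 7 2, Store 13 10, Const 18 0,
    Send 16 7 4, Recv 16 12, JumpLeq 4 4 65, Arith Sub 16 0 5, Store 12 2,
    Store 13 4, Arith Sub 9 9 5, Recv 16 7, Send 16 12 4, JumpLeq 4 4 65,
    Load 14 7, Load 15 12, Arith Add 2 14 15, JumpLeq 4 4 45, JumpLeq 1 11 71,
    Send 11 10 19]"

lemma length_build_prog: "length build_prog = 71"
  by (simp add: build_prog_def)

lemma build_prog_nth:
  "build_prog ! 0 = Const 4 1" "build_prog ! Suc 0 = Const 5 1"
  "build_prog ! 2 = Const 7 0" "build_prog ! 3 = Const 8 3"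
  "build_prog ! 4 = Const 3 0" "build_prog ! 5 = Const 10 0"
  "build_prog ! 6 = Const 17 2" "build_prog ! 7 = Arith Add 9 0 10"
  "build_prog ! 8 = Arith Add 6 5 5" "build_prog ! 9 = JumpLeq 6 1 11"
  "build_prog ! 10 = JumpLeq 4 4 15" "build_prog ! 11 = Arith Add 5 5 5"
  "build_prog ! 12 = Arith Add 7 7 8" "build_prog ! 13 = Arith Add 3 3 4"
  "build_prog ! 14 = JumpLeq 4 4 8" "build_prog ! 15 = Arith Add 12 7 4"
  "build_prog ! 16 = Arith Add 13 12 4" "build_prog ! 17 = Arith Add 19 7 10"
  "build_prog ! 18 = JumpLeq 5 0 29" "build_prog ! 19 = Arith Add 11 0 5"
  "build_prog ! 20 = JumpLeq 1 11 37" "build_prog ! 21 = Store 7 2"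
  "build_prog ! 22 = Store 13 10" "build_prog ! 23 = Recv 11 12"
  "build_prog ! 24 = Send 11 7 4" "build_prog ! 25 = Load 14 12"
  "build_prog ! 26 = Arith Add 2 2 14" "build_prog ! 27 = Arith Add 3 3 4"
  "build_prog ! 28 = JumpLeq 4 4 45" "build_prog ! 29 = Arith Sub 11 0 5"
  "build_prog ! 30 = Store 12 2" "build_prog ! 31 = Store 13 4"
  "build_prog ! 32 = Arith Add 3 3 4" "build_prog ! 33 = Send 11 12 4"
  "build_prog ! 34 = Recv 11 7" "build_prog ! 35 = Recv 11 10"
  "build_prog ! 36 = JumpLeq 4 4 71" "build_prog ! 37 = Const 18 0"
  "build_prog ! 38 = Const 18 0" "build_prog ! 39 = Const 18 0"
  "build_prog ! 40 = Const 18 0" "build_prog ! 41 = Const 18 0"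
  "build_prog ! 42 = Const 18 0" "build_prog ! 43 = Const 18 0"
  "build_prog ! 44 = Const 18 0" "build_prog ! 45 = JumpLeq 7 10 69"
  "build_prog ! 46 = Arith Sub 7 7 8" "build_prog ! 47 = Arith Div 5 5 17"
  "build_prog ! 48 = Arith Add 12 7 4" "build_prog ! 49 = Arith Add 13 12 4"
  "build_prog ! 50 = JumpLeq 5 9 58" "build_prog ! 51 = Arith Add 16 0 5"
  "build_prog ! 52 = Store 7 2" "build_prog ! 53 = Store 13 10"
  "build_prog ! 54 = Const 18 0" "build_prog ! 55 = Send 16 7 4"
  "build_prog ! 56 = Recv 16 12" "build_prog ! 57 = JumpLeq 4 4 65"
  "build_prog ! 58 = Arith Sub 16 0 5" "build_prog ! 59 = Store 12 2"
  "build_prog ! 60 = Store 13 4" "build_prog ! 61 = Arith Sub 9 9 5"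
  "build_prog ! 62 = Recv 16 7" "build_prog ! 63 = Send 16 12 4"
  "build_prog ! 64 = JumpLeq 4 4 65" "build_prog ! 65 = Load 14 7"
  "build_prog ! 66 = Load 15 12" "build_prog ! 67 = Arith Add 2 14 15"
  "build_prog ! 68 = JumpLeq 4 4 45" "build_prog ! 69 = JumpLeq 1 11 71"
  "build_prog ! 70 = Send 11 10 19"
  by (simp_all add: build_prog_def)

section \<open>Symbolic execution of the building program\<close>

lemmas build_run_simps = runs_local length_build_prog build_prog_nth state_simps

lemma build_init:
  assumes "pc x = 0"
  shows "\<exists>y. runs E build_prog i 8 x y \<and> pc y = 8 \<and> reg y 4 = 1 \<and> reg y 5 = 1 \<and> reg y 7 = 0 \<and>
    reg y 8 = 3 \<and> reg y 3 = 0 \<and> reg y 10 = 0 \<and> reg y 17 = 2 \<and> reg y 9 = reg x 0 \<and>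
    reg y 0 = reg x 0 \<and> reg y 1 = reg x 1 \<and> reg y 2 = reg x 2 \<and> clock y = clock x + 8"
  using assms by (simp add: build_run_simps numeral_2_eq_2[symmetric])

text \<open>The loop stops at the exponent whose next doubling would exceed \<open>p\<close>. A
  doubling takes 6 instructions, the failing test with the exit jump 3.\<close>

lemma build_double:
  assumes "pc x = 8" "reg x 4 = 1" "reg x 5 = 2 ^ e" "reg x 7 = 3 * real e" "reg x 8 = 3"
    "reg x 3 = real e" "reg x 1 = real p" and "2 ^ h \<le> p" "p < 2 ^ Suc h" "e \<le> h"
  shows "\<exists>y. runs E build_prog i (6 * (h - e) + 3) x y \<and> pc y = 15 \<and> reg y 5 = 2 ^ h \<and>
    reg y 7 = 3 * real h \<and> reg y 3 = real h \<and> (\<forall>r. r \<notin> {3, 5, 6, 7} \<longrightarrow> reg y r = reg x r) \<and>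
    clock y = clock x + 6 * (real h - real e) + 3"
  using assms
proof (induction "h - e" arbitrary: e x)
  case 0
  have "real p < real (2 ^ Suc h)" using 0(10) by (simp only: of_nat_less_iff)
  then have p: "\<not> 2 * 2 ^ h \<le> real p" by simp
  have "e = h" using 0 by simp
  then show ?case
    using 0(2-8) p by (simp add: build_run_simps)
next
  case (Suc n)
  have "2 ^ Suc e \<le> (2 :: nat) ^ h" using Suc(2,12) by (intro power_increasing) auto
  then have "real (2 ^ Suc e) \<le> real p" using Suc(10) by (simp only: of_nat_le_iff)
  then have p: "2 * 2 ^ e \<le> real p" by simp
  have "\<exists>y. runs E build_prog i 6 x y \<and> pc y = 8 \<and> reg y 4 = 1 \<and> reg y 5 = 2 ^ Suc e \<and>
      reg y 7 = 3 * real (Suc e) \<and> reg y 8 = 3 \<and> reg y 3 = real (Suc e) \<and> reg y 1 = real p \<and>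
      (\<forall>r. r \<notin> {3, 5, 6, 7} \<longrightarrow> reg y r = reg x r) \<and> clock y = clock x + 6"
    using Suc(3-9) p by (simp add: build_run_simps)
  then obtain y where y: "runs E build_prog i 6 x y" "pc y = 8" "reg y 4 = 1" "reg y 5 = 2 ^ Suc e"
      "reg y 7 = 3 * real (Suc e)" "reg y 8 = 3" "reg y 3 = real (Suc e)" "reg y 1 = real p"
      "\<forall>r. r \<notin> {3, 5, 6, 7} \<longrightarrow> reg y r = reg x r" "clock y = clock x + 6"
    by blast
  have "n = h - Suc e" "Suc e \<le> h" using Suc(2) by auto
  from Suc(1)[OF this(1) y(2-8) Suc(10,11) this(2)]
  obtain z where z: "runs E build_prog i (6 * (h - Suc e) + 3) y z" "pc z = 15" "reg z 5 = 2 ^ h"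
    "reg z 7 = 3 * real h" "reg z 3 = real h" "\<forall>r. r \<notin> {3, 5, 6, 7} \<longrightarrow> reg z r = reg y r"
    "clock z = clock y + 6 * (real h - real (Suc e)) + 3"
    by blast
  have "6 * (h - e) + 3 = 6 + (6 * (h - Suc e) + 3)" using Suc(2) by simp
  then have "runs E build_prog i (6 * (h - e) + 3) x z"
    using runs_add[OF y(1) z(1)] by simp
  then show ?case using z(2-7) y(9,10) by (intro exI[of _ z]) simp
qed

lemma idx_simps: "idx 0 = 0" "idx 1 = 1" "idx (real d) = d" "idx (3 * real d) = 3 * d"
    "idx (3 * real d + 1) = Suc (3 * d)" "idx (1 + 3 * real d) = Suc (3 * d)"
    "idx (3 * real d + 2) = Suc (Suc (3 * d))" "idx (2 + 3 * real d) = Suc (Suc (3 * d))"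
  by (auto intro!: idx_of_nat)

text \<open>This preparation takes 8 steps for each of the three kinds of PEs, so that partners
  reach the leaf exchange in the same machine step.\<close>

lemma build_upper_init:
  assumes "pc x = 15" "reg x 4 = 1" "reg x 5 \<le> reg x 0" "reg x 7 = 3 * real d" "reg x 10 = 0"
  shows "\<exists>y. runs E build_prog i 8 x y \<and> pc y = 33 \<and> reg y 11 = reg x 0 - reg x 5 \<and>
    reg y 12 = 3 * real d + 1 \<and> reg y 3 = reg x 3 + 1 \<and> reg y 19 = 3 * real d \<and>
    (\<forall>r. r \<notin> {3, 11, 12, 13, 19} \<longrightarrow> reg y r = reg x r) \<and>
    mem y = (mem x)(Suc (3 * d) := reg x 2, Suc (Suc (3 * d)) := 1) \<and> clock y = clock x + 8"
  using assms by (simp add: build_run_simps idx_simps)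

lemma build_lower_init:
  assumes "pc x = 15" "reg x 4 = 1" "\<not> reg x 5 \<le> reg x 0" "\<not> reg x 1 \<le> reg x 0 + reg x 5"
    "reg x 7 = 3 * real d" "reg x 10 = 0"
  shows "\<exists>y. runs E build_prog i 8 x y \<and> pc y = 23 \<and> reg y 11 = reg x 0 + reg x 5 \<and>
    reg y 12 = 3 * real d + 1 \<and> reg y 19 = 3 * real d \<and>
    (\<forall>r. r \<notin> {11, 12, 13, 19} \<longrightarrow> reg y r = reg x r) \<and>
    mem y = (mem x)(3 * d := reg x 2, Suc (Suc (3 * d)) := 0) \<and> clock y = clock x + 8"
  using assms by (simp add: build_run_simps idx_simps)

lemma build_single_init:
  assumes "pc x = 15" "reg x 4 = 1" "\<not> reg x 5 \<le> reg x 0" "reg x 1 \<le> reg x 0 + reg x 5"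
    "reg x 7 = 3 * real d" "reg x 10 = 0"
  shows "\<exists>y. runs E build_prog i 8 x y \<and> pc y = 39 \<and> reg y 11 = reg x 0 + reg x 5 \<and>
    reg y 19 = 3 * real d \<and>
    (\<forall>r. r \<notin> {11, 12, 13, 18, 19} \<longrightarrow> reg y r = reg x r) \<and>
    mem y = mem x \<and> clock y = clock x + 8"
  using assms by (simp add: build_run_simps idx_simps)

lemma build_lower_sum:
  assumes "pc x = 25" "reg x 4 = 1" "reg x 12 = 3 * real d + 1"
  shows "\<exists>y. runs E build_prog i 4 x y \<and> pc y = 45 \<and> reg y 2 = reg x 2 + mem x (Suc (3 * d)) \<and>
    reg y 3 = reg x 3 + 1 \<and> (\<forall>r. r \<notin> {2, 3, 14} \<longrightarrow> reg y r = reg x r) \<and>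
    mem y = mem x \<and> clock y = clock x + 4"
  using assms by (simp add: build_run_simps idx_simps)

lemma build_single_wait:
  assumes "pc x = 41"
  shows "\<exists>y. runs E build_prog i 4 x y \<and> pc y = 45 \<and> (\<forall>r. r \<noteq> 18 \<longrightarrow> reg y r = reg x r) \<and>
    mem y = mem x \<and> clock y = clock x + 4"
  using assms by (simp add: build_run_simps)

text \<open>As many steps as with a set bit: the idle instruction here balances the reduction of
  register 9 there.\<close>

lemma build_round_lower:
  assumes "pc x = 45" "reg x 4 = 1" "reg x 5 = 2 * D" "reg x 7 = 3 * real (Suc d)" "reg x 8 = 3"
    "reg x 10 = 0" "reg x 17 = 2" "\<not> D \<le> reg x 9"
  shows "\<exists>y. runs E build_prog i 10 x y \<and> pc y = 55 \<and> reg y 5 = D \<and> reg y 7 = 3 * real d \<and>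
    reg y 12 = 3 * real d + 1 \<and> reg y 16 = reg x 0 + D \<and>
    (\<forall>r. r \<notin> {5, 7, 12, 13, 16, 18} \<longrightarrow> reg y r = reg x r) \<and>
    mem y = (mem x)(3 * d := reg x 2, Suc (Suc (3 * d)) := 0) \<and> clock y = clock x + 10"
  using assms by (simp add: build_run_simps idx_simps)

lemma build_round_upper:
  assumes "pc x = 45" "reg x 4 = 1" "reg x 5 = 2 * D" "reg x 7 = 3 * real (Suc d)" "reg x 8 = 3"
    "reg x 10 = 0" "reg x 17 = 2" "D \<le> reg x 9"
  shows "\<exists>y. runs E build_prog i 10 x y \<and> pc y = 62 \<and> reg y 5 = D \<and> reg y 7 = 3 * real d \<and>
    reg y 12 = 3 * real d + 1 \<and> reg y 16 = reg x 0 - D \<and> reg y 9 = reg x 9 - D \<and>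
    (\<forall>r. r \<notin> {5, 7, 9, 12, 13, 16} \<longrightarrow> reg y r = reg x r) \<and>
    mem y = (mem x)(Suc (3 * d) := reg x 2, Suc (Suc (3 * d)) := 1) \<and> clock y = clock x + 10"
  using assms by (simp add: build_run_simps idx_simps)

lemma build_round_merge:
  assumes "pc x = 57 \<or> pc x = 64" "reg x 4 = 1" "reg x 7 = 3 * real d" "reg x 12 = 3 * real d + 1"
  shows "\<exists>y. runs E build_prog i 5 x y \<and> pc y = 45 \<and>
    reg y 2 = mem x (3 * d) + mem x (Suc (3 * d)) \<and>
    (\<forall>r. r \<notin> {2, 14, 15} \<longrightarrow> reg y r = reg x r) \<and> mem y = mem x \<and> clock y = clock x + 5"
  using assms by (elim disjE) (simp_all add: build_run_simps idx_simps)

lemma build_exit_single: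
  assumes "pc x = 45" "reg x 7 = 0" "reg x 10 = 0" "reg x 1 \<le> reg x 11"
  shows "\<exists>y. runs E build_prog i 2 x y \<and> pc y = 71 \<and> reg y = reg x \<and> mem y = mem x \<and>
    clock y = clock x + 2"
  using assms by (simp add: build_run_simps)

lemma build_exit_lower:
  assumes "pc x = 45" "reg x 7 = 0" "reg x 10 = 0" "\<not> reg x 1 \<le> reg x 11"
  shows "\<exists>y. runs E build_prog i 2 x y \<and> pc y = 70 \<and> reg y = reg x \<and> mem y = mem x \<and>
    clock y = clock x + 2"
  using assms by (simp add: build_run_simps)

lemma build_exit_upper:
  assumes "pc x = 36" "reg x 4 = 1"
  shows "\<exists>y. runs E build_prog i 1 x y \<and> pc y = 71 \<and> reg y = reg x \<and> mem y = mem x \<and>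
    clock y = clock x + 1"
  using assms by (simp add: build_run_simps)

section \<open>Delivery of messages\<close>

lemma sends_one:
  assumes "pc x < length P" "P ! pc x = Send j a l" "reg x l = 1"
  shows "sends P x = Some (idx (reg x j), [mem x (idx (reg x a))])"
  using assms by (simp add: sends_def halted_def idx_simps)

lemma receives_Recv:
  "pc x < length P \<Longrightarrow> P ! pc x = Recv j a \<Longrightarrow> receives P x = Some (idx (reg x j), idx (reg x a))"
  by (simp add: receives_def halted_def)

lemma sends_receives: "sends P x = Some m \<Longrightarrow> \<not> halted P x \<and> receives P x = None"
  by (auto simp: sends_def receives_def split: if_splits instr.splits)

lemma receives_sends: "receives P x = Some m \<Longrightarrow> \<not> halted P x \<and> sends P x = None"
  by (auto simp: sends_def receives_def split: if_splits instr.splits)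

lemma machine_step_deliver:
  assumes "i < npes E" "j < npes E" "sends P (s i) = Some (j, msg)" "receives P (s j) = Some (i, a)"
  defines "c \<equiv> max (clock (s i)) (clock (s j)) + alpha E + real (length msg) * beta E"
  shows "machine_step E P s i = (s i)\<lparr>pc := Suc (pc (s i)), clock := c\<rparr>"
    and "machine_step E P s j =
      (s j)\<lparr>pc := Suc (pc (s j)), mem := write_block a msg (mem (s j)), clock := c\<rparr>"
  using assms sends_receives[OF assms(3)] receives_sends[OF assms(4)]
  by (simp_all add: machine_step_def Let_def comm_end_def max.commute)

lemma write_block_one: "write_block a [v] \<mu> = \<mu>(a := v)"
  by (auto simp: write_block_def fun_eq_iff)

lemma machine_step_deliver_one:
  assumes "i < npes E" "j < npes E" "sends P (s i) = Some (j, [v])" "receives P (s j) = Some (i, a)"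
    and "clock (s i) \<le> B" "clock (s j) \<le> B"
  obtains c where "c \<le> B + (alpha E + beta E)"
    "machine_step E P s i = (s i)\<lparr>pc := Suc (pc (s i)), clock := c\<rparr>"
    "machine_step E P s j = (s j)\<lparr>pc := Suc (pc (s j)), mem := (mem (s j))(a := v), clock := c\<rparr>"
proof (rule that)
  show "max (clock (s i)) (clock (s j)) + alpha E + real (length [v]) * beta E
      \<le> B + (alpha E + beta E)"
    using assms(5,6) by simp
qed (use machine_step_deliver[where s = s, OF assms(1-4)] in \<open>simp_all add: write_block_one\<close>)

lemma machine_step_wait:
  assumes "receives P (s i) = Some (j, a)" "\<And>msg. sends P (s j) \<noteq> Some (i, msg)"
  shows "machine_step E P s i = s i"
  using assms receives_sends[OF assms(1)]
  by (auto simp: machine_step_def Let_def split: option.splits)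

lemma machine_step_local:
  assumes "i < npes E" "pc (s i) < length P" "is_local (P ! pc (s i))"
  shows "machine_step E P s i = exec E i (P ! pc (s i)) (s i)"
  using assms local_sends_receives[OF assms(3)] by (simp add: machine_step_def Let_def halted_def)

section \<open>The phases of the building program\<close>

context
  fixes E :: env and W :: "nat \<Rightarrow> real" and h :: nat
  assumes p: "2 ^ h \<le> npes E" "npes E < 2 ^ Suc h"
begin

definition round_cost :: real where "round_cost = alpha E + beta E"

definition common :: "nat \<Rightarrow> pe_state \<Rightarrow> bool" where
  "common i x \<longleftrightarrow> reg x 0 = real i \<and> reg x 1 = real (npes E) \<and> reg x 4 = 1 \<and> reg x 8 = 3 \<and>
     reg x 10 = 0 \<and> reg x 17 = 2 \<and> reg x 19 = 3 * real h"

definition stored :: "nat \<Rightarrow> nat \<Rightarrow> pe_state \<Rightarrow> bool" where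
  "stored i e x \<longleftrightarrow> (mem x (3 * e), mem x (Suc (3 * e)), mem x (Suc (Suc (3 * e)))) =
     path_entry (npes E) W i e"

text \<open>State of the leaf exchange after \<open>k\<close> of its two messages.\<close>

definition pairing :: "nat \<Rightarrow> real \<Rightarrow> nat \<Rightarrow> pe_state \<Rightarrow> bool" where
  "pairing k B i x \<longleftrightarrow> clock x \<le> B \<and> common i x \<and> reg x 7 = 3 * real h \<and>
     (2 ^ h \<le> i \<longrightarrow> pc x = 33 + k \<and> reg x 11 = real (i - 2 ^ h) \<and> reg x 12 = 3 * real h + 1 \<and>
       reg x 3 = real (Suc h) \<and> mem x (Suc (3 * h)) = W i \<and> mem x (Suc (Suc (3 * h))) = 1 \<and>
       (k = 2 \<longrightarrow> mem x (3 * h) = W (i - 2 ^ h))) \<and>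
     (i < 2 ^ h \<longrightarrow> reg x 11 = real (i + 2 ^ h) \<and> reg x 5 = 2 ^ h \<and> reg x 9 = real i \<and>
       reg x 2 = W i \<and> reg x 3 = real h \<and>
       (if i + 2 ^ h < npes E
        then pc x = 23 + k \<and> reg x 12 = 3 * real h + 1 \<and> mem x (3 * h) = W i \<and>
          mem x (Suc (Suc (3 * h))) = 0 \<and> (1 \<le> k \<longrightarrow> mem x (Suc (3 * h)) = W (i + 2 ^ h))
        else pc x = 39 + k))"

lemma real_lower: "real i < 2 ^ h \<longleftrightarrow> i < 2 ^ h" "2 ^ h \<le> real i \<longleftrightarrow> 2 ^ h \<le> i"
  "real (npes E) \<le> real i + 2 ^ h \<longleftrightarrow> npes E \<le> i + 2 ^ h"
  by (metis of_nat_less_iff of_nat_numeral of_nat_power,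
      metis of_nat_le_iff of_nat_numeral of_nat_power,
      metis of_nat_le_iff of_nat_numeral of_nat_power of_nat_add)

text \<open>The count is 8 initial instructions, \<open>6 * h + 3\<close> for the doubling and 8
  before the leaf exchange.\<close>

lemma pairing_start:
  assumes "ready (npes E) i x" "reg x 2 = W i" "i < npes E"
  shows "\<exists>y. runs E build_prog i (6 * h + 19) x y \<and> pairing 0 (6 * real h + 19) i y"
proof -
  have x: "pc x = 0" "clock x = 0" "reg x 0 = real i" "reg x 1 = real (npes E)"
    using assms(1) by (auto simp: ready_def)
  obtain y where y: "runs E build_prog i 8 x y" "pc y = 8" "reg y 4 = 1" "reg y 5 = 1" "reg y 7 = 0"
    "reg y 8 = 3" "reg y 3 = 0" "reg y 10 = 0" "reg y 17 = 2" "reg y 9 = real i" "reg y 0 = real i"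
    "reg y 1 = real (npes E)" "reg y 2 = W i" "clock y = 8"
    using build_init[OF x(1), of E i] x assms(2) by auto
  obtain z where z: "runs E build_prog i (6 * (h - 0) + 3) y z" "pc z = 15" "reg z 5 = 2 ^ h"
    "reg z 7 = 3 * real h" "reg z 3 = real h" "\<forall>r. r \<notin> {3, 5, 6, 7} \<longrightarrow> reg z r = reg y r"
    "clock z = clock y + 6 * (real h - real 0) + 3"
    using build_double[of y 0 "npes E" h E i] y p by auto
  have zr: "reg z 4 = 1" "reg z 8 = 3" "reg z 10 = 0" "reg z 17 = 2" "reg z 9 = real i"
    "reg z 0 = real i" "reg z 1 = real (npes E)" "reg z 2 = W i" "clock z = 6 * real h + 11"
    using y z(6,7) by simp_all
  have "\<exists>u. runs E build_prog i 8 z u \<and> pairing 0 (6 * real h + 19) i u"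
  proof -
    consider "2 ^ h \<le> i" | "i < 2 ^ h" "i + 2 ^ h < npes E" | "i < 2 ^ h" "npes E \<le> i + 2 ^ h"
      by linarith
    then show ?thesis
    proof cases
      case 1
      then obtain u where "runs E build_prog i 8 z u" "pc u = 33" "reg u 11 = reg z 0 - reg z 5"
        "reg u 12 = 3 * real h + 1" "reg u 3 = reg z 3 + 1" "reg u 19 = 3 * real h"
        "\<forall>r. r \<notin> {3, 11, 12, 13, 19} \<longrightarrow> reg u r = reg z r"
        "mem u = (mem z)(Suc (3 * h) := reg z 2, Suc (Suc (3 * h)) := 1)" "clock u = clock z + 8"
        using build_upper_init[of z h E i] z(2-5) zr by (auto simp: real_lower)
      then show ?thesis
        using 1 z(2-5) zr by (intro exI[of _ u]) (simp add: pairing_def common_def of_nat_diff)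
    next
      case 2
      then obtain u where "runs E build_prog i 8 z u" "pc u = 23" "reg u 11 = reg z 0 + reg z 5"
        "reg u 12 = 3 * real h + 1" "reg u 19 = 3 * real h"
        "\<forall>r. r \<notin> {11, 12, 13, 19} \<longrightarrow> reg u r = reg z r"
        "mem u = (mem z)(3 * h := reg z 2, Suc (Suc (3 * h)) := 0)" "clock u = clock z + 8"
        using build_lower_init[of z h E i] z(2-5) zr by (auto simp: real_lower)
      then show ?thesis
        using 2 z(2-5) zr by (intro exI[of _ u]) (simp add: pairing_def common_def)
    next
      case 3
      then obtain u where "runs E build_prog i 8 z u" "pc u = 39" "reg u 11 = reg z 0 + reg z 5"
        "reg u 19 = 3 * real h" "\<forall>r. r \<notin> {11, 12, 13, 18, 19} \<longrightarrow> reg u r = reg z r"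
        "mem u = mem z" "clock u = clock z + 8"
        using build_single_init[of z h E i] z(2-5) zr by (auto simp: real_lower)
      then show ?thesis
        using 3 z(2-5) zr by (intro exI[of _ u]) (simp add: pairing_def common_def)
    qed
  qed
  then obtain u where u: "runs E build_prog i 8 z u" "pairing 0 (6 * real h + 19) i u" by blast
  have "6 * h + 19 = 8 + ((6 * (h - 0) + 3) + 8)" by simp
  then show ?thesis
    using runs_add[OF y(1) runs_add[OF z(1) u(1)]] u(2) by metis
qed

lemma upper_half: "2 ^ h \<le> i \<Longrightarrow> i < npes E \<Longrightarrow> i - 2 ^ h < 2 ^ h \<and> i - 2 ^ h + 2 ^ h = i"
  using p unfolding power_Suc by linarith

lemma round_cost_ge: "1 \<le> beta E \<Longrightarrow> beta E \<le> alpha E \<Longrightarrow> 1 \<le> round_cost"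
  by (simp add: round_cost_def)

text \<open>The PE with the larger rank first sends and then receives, its sibling does the reverse.
  A PE without a sibling spends one instruction, which \<open>round_cost\<close> covers.\<close>

lemma pairing_step:
  assumes "1 \<le> beta E" "beta E \<le> alpha E" and k: "k < 2"
    and s: "\<And>i. i < npes E \<Longrightarrow> pairing k B i (s i)" and "i < npes E"
  shows "pairing (Suc k) (B + round_cost) i (machine_step E build_prog s i)"
proof -
  have pair: "pairing (Suc k) (B + round_cost) i (machine_step E build_prog s i) \<and>
      pairing (Suc k) (B + round_cost) (i + 2 ^ h) (machine_step E build_prog s (i + 2 ^ h))"
    if i: "i < 2 ^ h" "i + 2 ^ h < npes E" for i
  proof -
    let ?j = "i + 2 ^ h"
    have x: "pairing k B i (s i)" and y: "pairing k B ?j (s ?j)" using s i by auto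
    have ij: "i < npes E" "?j < npes E" using i by auto
    have clocks: "clock (s i) \<le> B" "clock (s ?j) \<le> B"
      using x y by (auto simp: pairing_def)
    show ?thesis
    proof (cases "k = 0")
      case True
      have "sends build_prog (s ?j) = Some (i, [W ?j])"
        using y True
        by (subst sends_one) (auto simp: pairing_def common_def build_prog_nth length_build_prog idx_simps)
      moreover have "receives build_prog (s i) = Some (?j, Suc (3 * h))"
        using x True i
        by (subst receives_Recv)
          (auto simp: pairing_def common_def build_prog_nth length_build_prog idx_simps
            simp del: of_nat_add)
      ultimately obtain c where "c \<le> B + (alpha E + beta E)"
        "machine_step E build_prog s ?j = (s ?j)\<lparr>pc := Suc (pc (s ?j)), clock := c\<rparr>"
        "machine_step E build_prog s i =
          (s i)\<lparr>pc := Suc (pc (s i)), mem := (mem (s i))(Suc (3 * h) := W ?j), clock := c\<rparr>"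
        using machine_step_deliver_one[OF ij(2,1) _ _ clocks(2,1)] by metis
      then show ?thesis
        using x y i True by (simp add: pairing_def common_def round_cost_def)
    next
      case False
      then have k: "k = 1" using \<open>k < 2\<close> by simp
      have "sends build_prog (s i) = Some (?j, [W i])"
        using x k i
        by (subst sends_one)
          (auto simp: pairing_def common_def build_prog_nth length_build_prog idx_simps
            simp del: of_nat_add)
      moreover have "receives build_prog (s ?j) = Some (i, 3 * h)"
        using y k
        by (subst receives_Recv) (auto simp: pairing_def common_def build_prog_nth length_build_prog idx_simps)
      ultimately obtain c where "c \<le> B + (alpha E + beta E)"
        "machine_step E build_prog s i = (s i)\<lparr>pc := Suc (pc (s i)), clock := c\<rparr>"
        "machine_step E build_prog s ?j =
          (s ?j)\<lparr>pc := Suc (pc (s ?j)), mem := (mem (s ?j))(3 * h := W i), clock := c\<rparr>"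
        using machine_step_deliver_one[OF ij _ _ clocks] by metis
      then show ?thesis
        using x y i k by (simp add: pairing_def common_def round_cost_def)
    qed
  qed
  consider "2 ^ h \<le> i" | "i < 2 ^ h" "i + 2 ^ h < npes E" | "i < 2 ^ h" "npes E \<le> i + 2 ^ h"
    by linarith
  then show ?thesis
  proof cases
    case 1
    then show ?thesis
      using pair[of "i - 2 ^ h"] upper_half[OF 1 \<open>i < npes E\<close>] \<open>i < npes E\<close> by simp
  next
    case 2
    then show ?thesis using pair by blast
  next
    case 3
    have x: "pairing k B i (s i)" using s \<open>i < npes E\<close> by blast
    have pc: "pc (s i) = 39 \<and> k = 0 \<or> pc (s i) = 40 \<and> k = 1"
      using x 3 k by (auto simp: pairing_def)
    then have "build_prog ! pc (s i) = Const 18 0" "pc (s i) < length build_prog"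
      by (auto simp: build_prog_nth length_build_prog)
    then have "machine_step E build_prog s i = exec E i (Const 18 0) (s i)"
      using machine_step_local[OF \<open>i < npes E\<close>, of s build_prog] by simp
    then show ?thesis
      using x 3 pc round_cost_ge[OF assms(1,2)] by (auto simp: pairing_def common_def state_simps)
  qed
qed

abbreviation rw :: "nat \<Rightarrow> nat \<Rightarrow> real" where
  "rw \<equiv> residue_weight (npes E) W"

abbreviation len :: "nat \<Rightarrow> nat" where
  "len \<equiv> path_length (npes E) h"

text \<open>Invariant of the PEs below \<open>2 ^ h\<close>: the entries from depth \<open>d\<close>
  on are final, as the path is filled from the leaf upwards.\<close>

definition core :: "nat \<Rightarrow> nat \<Rightarrow> pe_state \<Rightarrow> bool" where
  "core d i x \<longleftrightarrow> common i x \<and> reg x 11 = real (i + 2 ^ h) \<and> reg x 3 = real (len i) \<and>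
     (\<forall>e. d \<le> e \<and> e < len i \<longrightarrow> stored i e x)"

text \<open>Invariant of the other PEs: they own only the entry at depth \<open>h\<close> and stay
  blocked until the butterfly is over.\<close>

definition waiting :: "nat \<Rightarrow> pe_state \<Rightarrow> bool" where
  "waiting i x \<longleftrightarrow> common i x \<and> pc x = 35 \<and> reg x 11 = real (i - 2 ^ h) \<and>
     reg x 3 = real (Suc h) \<and> stored i h x"

definition round_start :: "nat \<Rightarrow> real \<Rightarrow> nat \<Rightarrow> pe_state \<Rightarrow> bool" where
  "round_start d B i x \<longleftrightarrow> clock x \<le> B \<and> (2 ^ h \<le> i \<longrightarrow> waiting i x) \<and>
     (i < 2 ^ h \<longrightarrow> core d i x \<and> pc x = 45 \<and> reg x 7 = 3 * real d \<and> reg x 5 = 2 ^ d \<and>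
       reg x 9 = real (i mod 2 ^ d) \<and> reg x 2 = rw d i)"

lemma waiting_runs: "waiting i x \<Longrightarrow> runs E build_prog i N x x"
  by (rule runs_wait[THEN iffD2])
    (auto simp: receives_def halted_def waiting_def build_prog_nth length_build_prog)

lemma rw_single: "i < npes E \<Longrightarrow> rw (Suc h) i = W i"
  using residue_pes_singleton[of i "npes E" "Suc h"] p by (simp add: residue_weight_def)

lemma pairing_end:
  assumes "pairing 2 B i x" "i < npes E"
  shows "\<exists>y. runs E build_prog i 4 x y \<and> round_start h (B + 4) i y"
proof -
  consider "2 ^ h \<le> i" | "i < 2 ^ h" "i + 2 ^ h < npes E" | "i < 2 ^ h" "npes E \<le> i + 2 ^ h"
    by linarith
  then show ?thesis
  proof cases
    case 1
    note ih = upper_half[OF 1 assms(2)]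
    have "i mod 2 ^ h = (i - 2 ^ h) mod 2 ^ h"
      using 1 by (simp add: le_mod_geq)
    then have m: "i mod 2 ^ h = i - 2 ^ h" using ih by simp
    have "i mod 2 ^ Suc h = i" using p assms(2) by (intro mod_less) linarith
    then have u: "upper h i" using 1 by (simp add: upper_def)
    have "path_entry (npes E) W i h = (W (i - 2 ^ h), W i, 1)"
      using rw_single[OF assms(2)] rw_single[of "i - 2 ^ h"] assms(2) ih
      by (simp add: path_entry_def m u)
    then have "waiting i x"
      using assms(1) 1 by (auto simp: pairing_def waiting_def stored_def)
    then show ?thesis
      using 1 assms(1) waiting_runs[of i x 4] by (intro exI[of _ x]) (auto simp: round_start_def pairing_def)
  next
    case 2
    have x: "pc x = 25" "reg x 4 = 1" "reg x 12 = 3 * real h + 1"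
      using assms(1) 2 by (auto simp: pairing_def common_def)
    obtain y where y: "runs E build_prog i 4 x y" "pc y = 45" "reg y 2 = reg x 2 + mem x (Suc (3 * h))"
      "reg y 3 = reg x 3 + 1" "\<forall>r. r \<notin> {2, 3, 14} \<longrightarrow> reg y r = reg x r" "mem y = mem x"
      "clock y = clock x + 4"
      using build_lower_sum[OF x, of E i] by blast
    have "\<not> upper h i" using 2 by (simp add: upper_def)
    then have e: "path_entry (npes E) W i h = (W i, W (i + 2 ^ h), 0)"
      using rw_single[OF assms(2)] rw_single[of "i + 2 ^ h"] 2 by (simp add: path_entry_def)
    have r: "rw h i = W i + W (i + 2 ^ h)"
      using residue_weight_split[of "npes E" W h i] rw_single[OF assms(2)] rw_single[of "i + 2 ^ h"] 2
      by simp
    have l: "len i = Suc h" using 2 by (simp add: path_length_def)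
    have "stored i h' y" if "h \<le> h'" "h' < Suc h" for h'
    proof -
      have "h' = h" using that by simp
      then show ?thesis using e assms(1) 2 by (simp add: stored_def y(6) pairing_def)
    qed
    then show ?thesis
      using y assms(1) 2 r l
      by (intro exI[of _ y]) (simp add: round_start_def core_def pairing_def common_def)
  next
    case 3
    have x: "pc x = 41" using assms(1) 3 by (auto simp: pairing_def)
    obtain y where y: "runs E build_prog i 4 x y" "pc y = 45" "\<forall>r. r \<noteq> 18 \<longrightarrow> reg y r = reg x r"
      "mem y = mem x" "clock y = clock x + 4"
      using build_single_wait[OF x, of E i] by blast
    \<comment> \<open>A class with one member is a leaf at depth \<open>h\<close>, so there is no
      entry for depth \<open>h\<close>.\<close>
    have "residue_pes (npes E) h i = {i}"
      using residue_pes_singleton[OF assms(2)] 3 by simp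
    then have r: "rw h i = W i" by (simp add: residue_weight_def)
    have l: "len i = h" using 3 by (simp add: path_length_def)
    show ?thesis
      using y assms(1) 3 r l
      by (intro exI[of _ y]) (auto simp: round_start_def core_def pairing_def common_def)
  qed
qed

text \<open>State of the butterfly round for bit \<open>d\<close> after \<open>k\<close> of its two messages.\<close>

definition exchange :: "nat \<Rightarrow> nat \<Rightarrow> real \<Rightarrow> nat \<Rightarrow> pe_state \<Rightarrow> bool" where
  "exchange k d B i x \<longleftrightarrow> clock x \<le> B \<and> (2 ^ h \<le> i \<longrightarrow> waiting i x) \<and>
     (i < 2 ^ h \<longrightarrow> core (Suc d) i x \<and> reg x 7 = 3 * real d \<and> reg x 12 = 3 * real d + 1 \<and>
       reg x 5 = 2 ^ d \<and> reg x 9 = real (i mod 2 ^ d) \<and>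
       mem x (Suc (Suc (3 * d))) = of_bool (upper d i) \<and>
       (\<not> upper d i \<longrightarrow> pc x = 55 + k \<and> reg x 16 = real (i + 2 ^ d) \<and>
         mem x (3 * d) = rw (Suc d) i \<and> (k = 2 \<longrightarrow> mem x (Suc (3 * d)) = rw (Suc d) (i + 2 ^ d))) \<and>
       (upper d i \<longrightarrow> pc x = 62 + k \<and> reg x 16 = real (i - 2 ^ d) \<and>
         mem x (Suc (3 * d)) = rw (Suc d) i \<and> (1 \<le> k \<longrightarrow> mem x (3 * d) = rw (Suc d) (i - 2 ^ d))))"

text \<open>Address \<open>3 * Suc d\<close> is where the final entries begin, so a write to the
  entry in progress cannot damage them.\<close>

lemma core_update:
  assumes "core (Suc d) i x" "mem y = (mem x)(a := v)" "a < 3 * Suc d" "reg y = reg x"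
  shows "core (Suc d) i y"
proof -
  have "stored i e y = stored i e x" if "Suc d \<le> e" for e
    using assms(2,3) that by (simp add: stored_def)
  then show ?thesis using assms(1,4) by (simp add: core_def common_def)
qed

lemma exchange_start:
  assumes "round_start (Suc d) B i x"
  shows "\<exists>y. runs E build_prog i 10 x y \<and> exchange 0 d (B + 10) i y"
proof (cases "i < 2 ^ h")
  case False
  then have "waiting i x" using assms by (simp add: round_start_def)
  then show ?thesis
    using False assms waiting_runs[of i x 10]
    by (intro exI[of _ x]) (auto simp: round_start_def exchange_def)
next
  case True
  have x: "pc x = 45" "reg x 4 = 1" "reg x 5 = 2 * 2 ^ d" "reg x 7 = 3 * real (Suc d)" "reg x 8 = 3"
    "reg x 10 = 0" "reg x 17 = 2" "reg x 0 = real i" "reg x 9 = real (i mod 2 ^ Suc d)"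
    "reg x 2 = rw (Suc d) i" "core (Suc d) i x" "clock x \<le> B"
    using assms True by (auto simp: round_start_def core_def common_def)
  have up: "2 ^ d \<le> reg x 9 \<longleftrightarrow> upper d i"
    unfolding x(9) upper_def by (metis of_nat_le_iff of_nat_numeral of_nat_power)
  show ?thesis
  proof (cases "upper d i")
    case False
    obtain y where y: "runs E build_prog i 10 x y" "pc y = 55" "reg y 5 = 2 ^ d" "reg y 7 = 3 * real d"
      "reg y 12 = 3 * real d + 1" "reg y 16 = reg x 0 + 2 ^ d"
      "\<forall>r. r \<notin> {5, 7, 12, 13, 16, 18} \<longrightarrow> reg y r = reg x r"
      "mem y = (mem x)(3 * d := reg x 2, Suc (Suc (3 * d)) := 0)" "clock y = clock x + 10"
      using build_round_lower[OF x(1-7), of E i] False up by blast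
    have "stored i e y = stored i e x" if "Suc d \<le> e" for e
      using that by (simp add: stored_def y(8))
    then have "core (Suc d) i y"
      using x(11) y(7) by (simp add: core_def common_def)
    then show ?thesis
      using y x False True mod_power_Suc[of i d]
      by (intro exI[of _ y]) (simp add: exchange_def)
  next
    case up': True
    obtain y where y: "runs E build_prog i 10 x y" "pc y = 62" "reg y 5 = 2 ^ d" "reg y 7 = 3 * real d"
      "reg y 12 = 3 * real d + 1" "reg y 16 = reg x 0 - 2 ^ d" "reg y 9 = reg x 9 - 2 ^ d"
      "\<forall>r. r \<notin> {5, 7, 9, 12, 13, 16} \<longrightarrow> reg y r = reg x r"
      "mem y = (mem x)(Suc (3 * d) := reg x 2, Suc (Suc (3 * d)) := 1)" "clock y = clock x + 10"
      using build_round_upper[OF x(1-7), of E i] up' up by blast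
    have "stored i e y = stored i e x" if "Suc d \<le> e" for e
      using that by (simp add: stored_def y(9))
    then have "core (Suc d) i y"
      using x(11) y(8) by (simp add: core_def common_def)
    then show ?thesis
      using y x up' True mod_power_Suc[of i d] upper_diff(1)[OF up']
      by (intro exI[of _ y]) (simp add: exchange_def of_nat_diff)
  qed
qed

lemma exchange_step:
  assumes "1 \<le> beta E" "beta E \<le> alpha E" and k: "k < 2" and d: "d < h"
    and s: "\<And>i. i < npes E \<Longrightarrow> exchange k d B i (s i)" and "i < npes E"
  shows "exchange (Suc k) d (B + round_cost) i (machine_step E build_prog s i)"
proof -
  \<comment> \<open>Messages of a round stay below \<open>2 ^ h\<close>. In particular
    \<open>i - 2 ^ h\<close> sends nothing to a waiting PE \<open>i\<close>, whose receive is thus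
    not triggered too early.\<close>
  have partner: "\<exists>msg. sends build_prog (s i) = Some (j, msg) \<Longrightarrow> j < 2 ^ h" if "i < 2 ^ h" for i j
  proof -
    have x: "exchange k d B i (s i)" using s p that by auto
    assume *: "\<exists>msg. sends build_prog (s i) = Some (j, msg)"
    show "j < 2 ^ h"
    proof (cases "upper d i")
      case True
      have "reg (s i) 16 = real (i - 2 ^ d)" "pc (s i) = 62 + k"
        using x that True by (auto simp: exchange_def)
      then have "j = i - 2 ^ d"
        using * k by (cases "k = 0") (auto simp: sends_def halted_def build_prog_nth length_build_prog
          idx_simps less_2_cases_iff simp del: of_nat_diff split: if_splits)
      then show ?thesis using that by simp
    next
      case False
      have "reg (s i) 16 = real (i + 2 ^ d)" "pc (s i) = 55 + k"
        using x that False by (auto simp: exchange_def)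
      then have "j = i + 2 ^ d"
        using * k by (cases "k = 0") (auto simp: sends_def halted_def build_prog_nth length_build_prog
          idx_simps less_2_cases_iff simp del: of_nat_add split: if_splits)
      then show ?thesis using not_upper_add_less[OF False that d] by simp
    qed
  qed
  \<comment> \<open>Each pair is treated once, from its member with the clear bit; the other member
    is recovered by \<open>upper_diff\<close>.\<close>
  have pair: "exchange (Suc k) d (B + round_cost) i (machine_step E build_prog s i) \<and>
      exchange (Suc k) d (B + round_cost) (i + 2 ^ d) (machine_step E build_prog s (i + 2 ^ d))"
    if i: "i < 2 ^ h" "\<not> upper d i" for i
  proof -
    let ?j = "i + 2 ^ d"
    have j: "?j < 2 ^ h" "upper d ?j" using not_upper_add_less[OF i(2,1) d] not_upper_add[OF i(2)] by auto
    have ij: "i < npes E" "?j < npes E" using i j p by auto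
    have x: "exchange k d B i (s i)" and y: "exchange k d B ?j (s ?j)" using s ij by auto
    have clocks: "clock (s i) \<le> B" "clock (s ?j) \<le> B"
      using x y by (auto simp: exchange_def)
    have x': "core (Suc d) i (s i)" "reg (s i) 4 = 1" "reg (s i) 7 = 3 * real d"
        "reg (s i) 12 = 3 * real d + 1" "pc (s i) = 55 + k" "reg (s i) 16 = real ?j"
        "mem (s i) (3 * d) = rw (Suc d) i"
      and y': "core (Suc d) ?j (s ?j)" "reg (s ?j) 4 = 1" "reg (s ?j) 7 = 3 * real d"
        "reg (s ?j) 12 = 3 * real d + 1" "pc (s ?j) = 62 + k" "reg (s ?j) 16 = real i"
        "mem (s ?j) (Suc (3 * d)) = rw (Suc d) ?j"
      using x y i j by (auto simp: exchange_def core_def common_def)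
    show ?thesis
    proof (cases "k = 0")
      case True
      have "sends build_prog (s i) = Some (?j, [rw (Suc d) i])"
        using x' True
        by (subst sends_one) (auto simp: build_prog_nth length_build_prog idx_simps simp del: of_nat_add)
      moreover have "receives build_prog (s ?j) = Some (i, 3 * d)"
        using y' True
        by (subst receives_Recv) (auto simp: build_prog_nth length_build_prog idx_simps)
      ultimately obtain c where c: "c \<le> B + (alpha E + beta E)"
        "machine_step E build_prog s i = (s i)\<lparr>pc := Suc (pc (s i)), clock := c\<rparr>"
        "machine_step E build_prog s ?j =
          (s ?j)\<lparr>pc := Suc (pc (s ?j)), mem := (mem (s ?j))(3 * d := rw (Suc d) i), clock := c\<rparr>"
        using machine_step_deliver_one[OF ij _ _ clocks] by metis
      \<comment> \<open>Sending leaves the memory unchanged, cast as writing cell 0 with its own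
        value to fit \<open>core_update\<close>.\<close>
      have "core (Suc d) i (machine_step E build_prog s i)"
        by (rule core_update[OF x'(1), where a = 0 and v = "mem (s i) 0"]) (simp_all add: c(2))
      moreover have "core (Suc d) ?j (machine_step E build_prog s ?j)"
        by (rule core_update[OF y'(1), where a = "3 * d"]) (simp_all add: c(3))
      ultimately show ?thesis
        using x y i j True c by (simp add: exchange_def round_cost_def)
    next
      case False
      then have k: "k = 1" using \<open>k < 2\<close> by simp
      have "sends build_prog (s ?j) = Some (i, [rw (Suc d) ?j])"
        using y' k by (subst sends_one) (auto simp: build_prog_nth length_build_prog idx_simps)
      moreover have "receives build_prog (s i) = Some (?j, Suc (3 * d))"
        using x' k
        by (subst receives_Recv) (auto simp: build_prog_nth length_build_prog idx_simps simp del: of_nat_add)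
      ultimately obtain c where c: "c \<le> B + (alpha E + beta E)"
        "machine_step E build_prog s ?j = (s ?j)\<lparr>pc := Suc (pc (s ?j)), clock := c\<rparr>"
        "machine_step E build_prog s i =
          (s i)\<lparr>pc := Suc (pc (s i)), mem := (mem (s i))(Suc (3 * d) := rw (Suc d) ?j), clock := c\<rparr>"
        using machine_step_deliver_one[OF ij(2,1) _ _ clocks(2,1)] by metis
      have "core (Suc d) i (machine_step E build_prog s i)"
        by (rule core_update[OF x'(1), where a = "Suc (3 * d)"]) (simp_all add: c(3))
      moreover have "core (Suc d) ?j (machine_step E build_prog s ?j)"
        by (rule core_update[OF y'(1), where a = 0 and v = "mem (s ?j) 0"]) (simp_all add: c(2))
      ultimately show ?thesis
        using x y i j k c by (simp add: exchange_def round_cost_def)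
    qed
  qed
  consider "2 ^ h \<le> i" | "i < 2 ^ h" "\<not> upper d i" | "i < 2 ^ h" "upper d i" by linarith
  then show ?thesis
  proof cases
    case 1
    have x: "exchange k d B i (s i)" using s \<open>i < npes E\<close> by blast
    then have w: "waiting i (s i)" using 1 by (simp add: exchange_def)
    then have r: "receives build_prog (s i) = Some (i - 2 ^ h, 0)"
      by (subst receives_Recv)
        (auto simp: waiting_def common_def build_prog_nth length_build_prog idx_simps simp del: of_nat_diff)
    have "machine_step E build_prog s i = s i"
      by (rule machine_step_wait[where s = s, OF r]) (use partner[of "i - 2 ^ h" i] upper_half[OF 1 \<open>i < npes E\<close>] 1 in auto)
    then show ?thesis
      using x 1 round_cost_ge[OF assms(1,2)] by (simp add: exchange_def)
  next
    case 2
    then show ?thesis using pair by blast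
  next
    case 3
    then show ?thesis
      using pair[of "i - 2 ^ d"] upper_diff[OF 3(2)] by simp
  qed
qed

lemma exchange_end:
  assumes "exchange 2 d B i x"
  shows "\<exists>y. runs E build_prog i 5 x y \<and> round_start d (B + 5) i y"
proof (cases "i < 2 ^ h")
  case False
  then have "waiting i x" using assms by (simp add: exchange_def)
  then show ?thesis
    using False assms waiting_runs[of i x 5]
    by (intro exI[of _ x]) (auto simp: round_start_def exchange_def)
next
  case True
  have x: "pc x = 57 \<or> pc x = 64" "reg x 4 = 1" "reg x 7 = 3 * real d" "reg x 12 = 3 * real d + 1"
    "core (Suc d) i x" "clock x \<le> B"
    using assms True by (auto simp: exchange_def core_def common_def)
  obtain y where y: "runs E build_prog i 5 x y" "pc y = 45"
    "reg y 2 = mem x (3 * d) + mem x (Suc (3 * d))"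
    "\<forall>r. r \<notin> {2, 14, 15} \<longrightarrow> reg y r = reg x r" "mem y = mem x" "clock y = clock x + 5"
    using build_round_merge[OF x(1-4), of E i] by blast
  \<comment> \<open>The exchange names the sibling classes by the partners' ranks,
    \<open>path_entry\<close> by their least members; only the residue matters.\<close>
  have m: "mem x (3 * d) = rw (Suc d) (i mod 2 ^ d) \<and> mem x (Suc (3 * d)) = rw (Suc d) (i mod 2 ^ d + 2 ^ d)"
  proof (cases "upper d i")
    case up: True
    have "rw (Suc d) (i - 2 ^ d) = rw (Suc d) (i mod 2 ^ d)"
      using upper_diff(3)[OF up] by (intro residue_weight_cong) (metis mod_mod_trivial)
    moreover have "rw (Suc d) i = rw (Suc d) (i mod 2 ^ d + 2 ^ d)"
      using mod_power_Suc[of i d] up by (intro residue_weight_cong) (metis mod_mod_trivial)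
    ultimately show ?thesis using assms True up by (simp add: exchange_def)
  next
    case low: False
    have "rw (Suc d) (i + 2 ^ d) = rw (Suc d) (i mod 2 ^ d + 2 ^ d)"
      using not_upper_add(2)[OF low] by (intro residue_weight_cong) (metis mod_mod_trivial)
    moreover have "rw (Suc d) i = rw (Suc d) (i mod 2 ^ d)"
      using mod_power_Suc[of i d] low by (intro residue_weight_cong) (metis mod_mod_trivial)
    ultimately show ?thesis using assms True low by (simp add: exchange_def)
  qed
  then have "reg y 2 = rw d i"
    using y(3) residue_weight_split[of "npes E" W d i] by simp
  moreover have "core d i y"
  proof -
    have "stored i e y" if "d \<le> e" "e < len i" for e
    proof (cases "e = d")
      case True
      then show ?thesis
        using m assms \<open>i < 2 ^ h\<close> by (simp add: stored_def y(5) path_entry_def exchange_def)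
    next
      case False
      then show ?thesis using x(5) that by (simp add: core_def stored_def y(5))
    qed
    then show ?thesis using x(5) y(4) by (simp add: core_def common_def)
  qed
  ultimately show ?thesis
    using y assms True by (intro exI[of _ y]) (simp add: round_start_def exchange_def)
qed

section \<open>Composition of the phases\<close>

definition reaches :: "machine_state \<Rightarrow> machine_state \<Rightarrow> bool" where
  "reaches s s' \<longleftrightarrow> (\<exists>N. s' = (machine_step E build_prog ^^ N) s)"

lemma reaches_refl: "reaches s s"
  unfolding reaches_def by (rule exI[of _ 0]) simp

lemma reaches_step: "reaches s s' \<Longrightarrow> reaches s (machine_step E build_prog s')"
  unfolding reaches_def by (metis funpow.simps(2) o_apply)

text \<open>All PEs share one \<open>N\<close>, since the communication step that follows is taken
  by the whole machine; the padded branches make this possible.\<close>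

lemma reaches_runs:
  assumes "reaches s s'"
    and "\<And>i. i < npes E \<Longrightarrow> \<exists>y. runs E build_prog i N (s' i) y \<and> Q i y"
  shows "\<exists>s''. reaches s s'' \<and> (\<forall>i < npes E. Q i (s'' i))"
proof -
  obtain y where y: "\<And>i. i < npes E \<Longrightarrow> runs E build_prog i N (s' i) (y i) \<and> Q i (y i)"
    using assms(2) by metis
  let ?t = "(machine_step E build_prog ^^ N) s'"
  have t: "?t = (\<lambda>i. if i < npes E then y i else s' i)"
    using y by (intro runs_parallel) blast
  obtain M where "s' = (machine_step E build_prog ^^ M) s"
    using assms(1) unfolding reaches_def by blast
  then have "?t = (machine_step E build_prog ^^ (N + M)) s"
    unfolding funpow_add by simp
  then have "reaches s ?t" unfolding reaches_def by blast
  moreover have "Q i (?t i)" if "i < npes E" for i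
    using y[OF that] that by (simp add: t)
  ultimately show ?thesis by blast
qed

text \<open>A round consists of 10 instructions, two one-word messages and 5 instructions.\<close>

lemma build_rounds:
  assumes cost: "1 \<le> beta E" "beta E \<le> alpha E" and "d \<le> h" and "reaches s0 s"
    and "\<And>i. i < npes E \<Longrightarrow> round_start d B i (s i)"
  shows "\<exists>s'. reaches s0 s' \<and>
    (\<forall>i < npes E. round_start 0 (B + real d * (2 * round_cost + 15)) i (s' i))"
  using assms(3-5)
proof (induction d arbitrary: B s)
  case 0
  then show ?case by (intro exI[of _ s]) simp
next
  case (Suc d)
  let ?step = "machine_step E build_prog"
  have d: "d < h" using Suc.prems(1) by simp
  obtain s1 where "reaches s0 s1"
    and 1: "\<And>i. i < npes E \<Longrightarrow> exchange 0 d (B + 10) i (s1 i)"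
    using reaches_runs[OF Suc.prems(2) exchange_start[OF Suc.prems(3)]] by blast
  then have r: "reaches s0 (?step (?step s1))" by (intro reaches_step)
  have 2: "exchange (Suc 0) d (B + 10 + round_cost) i (?step s1 i)" if "i < npes E" for i
    by (rule exchange_step[OF cost _ d 1 that]) simp_all
  have 3: "exchange 2 d (B + 10 + round_cost + round_cost) i (?step (?step s1) i)"
    if "i < npes E" for i
    using exchange_step[OF cost _ d 2 that] by (simp add: numeral_2_eq_2)
  obtain s2 where "reaches s0 s2"
    and "\<And>i. i < npes E \<Longrightarrow> round_start d (B + 10 + round_cost + round_cost + 5) i (s2 i)"
    using reaches_runs[OF r exchange_end[OF 3]] by blast
  from Suc.IH[OF _ this] d show ?case
    by (simp add: algebra_simps)
qed

definition finish :: "real \<Rightarrow> nat \<Rightarrow> pe_state \<Rightarrow> bool" where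
  "finish B i x \<longleftrightarrow> clock x \<le> B \<and> (2 ^ h \<le> i \<longrightarrow> waiting i x) \<and>
     (i < 2 ^ h \<longrightarrow> core 0 i x \<and> pc x = (if i + 2 ^ h < npes E then 70 else 71))"

lemma finish_start:
  assumes "round_start 0 B i x"
  shows "\<exists>y. runs E build_prog i 2 x y \<and> finish (B + 2) i y"
proof (cases "i < 2 ^ h")
  case False
  then have "waiting i x" using assms by (simp add: round_start_def)
  then show ?thesis
    using False assms waiting_runs[of i x 2]
    by (intro exI[of _ x]) (auto simp: round_start_def finish_def)
next
  case True
  have x: "pc x = 45" "reg x 7 = 0" "reg x 10 = 0" "reg x 1 = real (npes E)"
    "reg x 11 = real (i + 2 ^ h)" "core 0 i x" "clock x \<le> B"
    using assms True by (auto simp: round_start_def core_def common_def)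
  have c: "core 0 i y" if "reg y = reg x" "mem y = mem x" for y
    using x(6) that by (simp add: core_def common_def stored_def)
  have le: "reg x 1 \<le> reg x 11 \<longleftrightarrow> npes E \<le> i + 2 ^ h"
    unfolding x(4,5) by (rule of_nat_le_iff)
  show ?thesis
  proof (cases "npes E \<le> i + 2 ^ h")
    case le': True
    then obtain y where "runs E build_prog i 2 x y" "pc y = 71" "reg y = reg x" "mem y = mem x"
      "clock y = clock x + 2"
      using build_exit_single[OF x(1-3), of E i] le by blast
    then show ?thesis
      using True le' c x(7) by (intro exI[of _ y]) (simp add: finish_def)
  next
    case gt: False
    then obtain y where "runs E build_prog i 2 x y" "pc y = 70" "reg y = reg x" "mem y = mem x"
      "clock y = clock x + 2"
      using build_exit_lower[OF x(1-3), of E i] le by blast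
    then show ?thesis
      using True gt c x(7) by (intro exI[of _ y]) (simp add: finish_def)
  qed
qed

definition built :: "real \<Rightarrow> nat \<Rightarrow> pe_state \<Rightarrow> bool" where
  "built B i x \<longleftrightarrow> clock x \<le> B \<and> reg x 4 = 1 \<and> reg x 3 = real (len i) \<and>
     (\<forall>e < len i. stored i e x) \<and> pc x = (if 2 ^ h \<le> i then 36 else 71)"

text \<open>Ranks that differ by \<open>2 ^ h\<close> agree in the lower bits, so the forwarded
  entries are valid for the receiver.\<close>

lemma path_entry_lower:
  assumes "2 ^ h \<le> i" "e < h"
  shows "path_entry (npes E) W (i - 2 ^ h) e = path_entry (npes E) W i e"
proof (rule path_entry_cong)
  have "(2 :: nat) ^ Suc e dvd 2 ^ h" using assms(2) by (intro le_imp_power_dvd) simp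
  then have "((i - 2 ^ h) + 2 ^ h) mod 2 ^ Suc e = (i - 2 ^ h) mod 2 ^ Suc e"
    by (metis add.right_neutral dvd_imp_mod_0 mod_add_right_eq)
  then show "(i - 2 ^ h) mod 2 ^ Suc e = i mod 2 ^ Suc e" using assms(1) by simp
qed

lemma finish_step:
  assumes cost: "1 \<le> beta E" "beta E \<le> alpha E"
    and s: "\<And>i. i < npes E \<Longrightarrow> finish B i (s i)" and "i < npes E"
  shows "built (B + (alpha E + 3 * real h * beta E)) i (machine_step E build_prog s i)"
proof -
  let ?B = "B + (alpha E + 3 * real h * beta E)"
  have B: "B \<le> ?B" using cost by simp
  have pair: "built ?B i (machine_step E build_prog s i) \<and>
      built ?B (i + 2 ^ h) (machine_step E build_prog s (i + 2 ^ h))"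
    if i: "i < 2 ^ h" "i + 2 ^ h < npes E" for i
  proof -
    let ?j = "i + 2 ^ h"
    have ij: "i < npes E" "?j < npes E" using i by auto
    have x: "core 0 i (s i)" "pc (s i) = 70" "clock (s i) \<le> B"
      and y: "waiting ?j (s ?j)" "clock (s ?j) \<le> B"
      using s[OF ij(1)] s[OF ij(2)] i by (auto simp: finish_def)
    have x11: "reg (s i) 11 = real ?j" "reg (s i) 10 = 0" "reg (s i) 19 = 3 * real h"
      using x(1) by (simp_all add: core_def common_def)
    define msg where "msg = map (mem (s i)) [0..<3 * h]"
    have "sends build_prog (s i) = Some (?j, msg)"
      using x(2) x11
      by (simp add: sends_def halted_def build_prog_nth length_build_prog idx_simps msg_def
        del: of_nat_add)
    moreover have "receives build_prog (s ?j) = Some (i, 0)"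
      using y(1) by (simp add: receives_def halted_def build_prog_nth length_build_prog idx_simps
        waiting_def common_def)
    ultimately have step: "machine_step E build_prog s i = (s i)\<lparr>pc := 71,
          clock := max (clock (s i)) (clock (s ?j)) + alpha E + real (length msg) * beta E\<rparr>"
      "machine_step E build_prog s ?j = (s ?j)\<lparr>pc := 36, mem := write_block 0 msg (mem (s ?j)),
          clock := max (clock (s i)) (clock (s ?j)) + alpha E + real (length msg) * beta E\<rparr>"
      using machine_step_deliver[OF ij, of build_prog s msg 0] x(2) y(1) by (simp_all add: waiting_def)
    have l: "len i = Suc h" "len ?j = Suc h" using i by (simp_all add: path_length_def)
    have clock: "max (clock (s i)) (clock (s ?j)) + alpha E + real (length msg) * beta E \<le> ?B"
      using x(3) y(2) by (simp add: msg_def)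
    have "built ?B i (machine_step E build_prog s i)"
      unfolding step(1) using x(1) i clock by (simp add: built_def core_def common_def stored_def)
    \<comment> \<open>The message fills the cells below \<open>3 * h\<close>; the entry at depth
      \<open>h\<close>, known since the leaf exchange, lies behind them.\<close>
    moreover have "stored ?j e (machine_step E build_prog s ?j)" if "e < Suc h" for e
    proof (cases "e < h")
      case True
      then have "stored i e (s i)" using x(1) l by (simp add: core_def)
      then show ?thesis
        using True path_entry_lower[of ?j e]
        by (simp add: stored_def step(2) write_block_def msg_def)
    next
      case False
      then have "e = h" using that by simp
      then show ?thesis
        using y(1) by (simp add: stored_def step(2) write_block_def msg_def waiting_def)
    qed
    ultimately show ?thesis
      using y(1) clock l by (simp add: built_def step(2) waiting_def common_def)
  qed
  consider "2 ^ h \<le> i" | "i < 2 ^ h" "i + 2 ^ h < npes E" | "i < 2 ^ h" "npes E \<le> i + 2 ^ h"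
    by linarith
  then show ?thesis
  proof cases
    case 1
    then show ?thesis
      using pair[of "i - 2 ^ h"] upper_half[OF 1 \<open>i < npes E\<close>] \<open>i < npes E\<close> by simp
  next
    case 2
    then show ?thesis using pair by blast
  next
    case 3
    have x: "finish B i (s i)" using s \<open>i < npes E\<close> by blast
    then have "machine_step E build_prog s i = s i"
      using 3 by (simp add: machine_step_def Let_def halted_def finish_def length_build_prog)
    then show ?thesis
      using x 3 B by (simp add: built_def finish_def core_def common_def)
  qed
qed

lemma built_end:
  assumes "built B i x" "i < npes E"
  shows "\<exists>y. runs E build_prog i 1 x y \<and> halted build_prog y \<and> clock y \<le> B + 1 \<and>
    holds_path (residue_tree (npes E) W 0 0) i y"
proof -
  have holds: "holds_path (residue_tree (npes E) W 0 0) i y" if "reg y = reg x" "mem y = mem x" for y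
    using assms that unfolding holds_path_def pe_path_root[OF p assms(2)]
    by (simp add: built_def stored_def)
  show ?thesis
  proof (cases "2 ^ h \<le> i")
    case True
    have "pc x = 36" "reg x 4 = 1" using assms True by (auto simp: built_def)
    from build_exit_upper[OF this, of E i] obtain y where
      "runs E build_prog i 1 x y" "pc y = 71" "reg y = reg x" "mem y = mem x" "clock y = clock x + 1"
      by blast
    then show ?thesis
      using holds assms by (intro exI[of _ y]) (simp add: halted_def length_build_prog built_def)
  next
    case False
    then have "halted build_prog x"
      using assms by (simp add: built_def halted_def length_build_prog)
    then show ?thesis
      using holds[OF refl refl] assms by (intro exI[of _ x]) (simp add: runs_wait built_def)
  qed
qed

lemma build_correct:
  assumes cost: "1 \<le> beta E" "beta E \<le> alpha E" and start: "build_start (npes E) W s"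
  shows "terminates E build_prog s \<and> (\<forall>i < npes E.
    clock (final E build_prog s i) \<le> 31 * (alpha E * (1 + real h)) \<and>
    holds_path (residue_tree (npes E) W 0 0) i (final E build_prog s i))"
proof -
  let ?step = "machine_step E build_prog"
  let ?b = "6 * real h + 19"
  have init: "\<exists>y. runs E build_prog i (6 * h + 19) (s i) y \<and> pairing 0 ?b i y" if "i < npes E" for i
    by (rule pairing_start) (use start that in \<open>auto simp: build_start_def\<close>)
  obtain s1 where "reaches s s1" and 1: "\<And>i. i < npes E \<Longrightarrow> pairing 0 ?b i (s1 i)"
    using reaches_runs[OF reaches_refl init] by blast
  then have r: "reaches s (?step (?step s1))" by (intro reaches_step)
  have 2: "pairing (Suc 0) (?b + round_cost) i (?step s1 i)" if "i < npes E" for i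
    by (rule pairing_step[OF cost _ 1 that]) simp_all
  have 3: "pairing 2 (?b + round_cost + round_cost) i (?step (?step s1) i)" if "i < npes E" for i
    using pairing_step[OF cost _ 2 that] by (simp add: numeral_2_eq_2)
  define c where "c = ?b + round_cost + round_cost + 4"
  obtain s2 where s2: "reaches s s2" "\<And>i. i < npes E \<Longrightarrow> round_start h c i (s2 i)"
    using reaches_runs[OF r pairing_end[OF 3]] unfolding c_def by blast
  define d where "d = c + real h * (2 * round_cost + 15)"
  obtain s3 where s3: "reaches s s3" "\<And>i. i < npes E \<Longrightarrow> round_start 0 d i (s3 i)"
    using build_rounds[OF cost order_refl s2] unfolding d_def by blast
  obtain s4 where "reaches s s4" and 4: "\<And>i. i < npes E \<Longrightarrow> finish (d + 2) i (s4 i)"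
    using reaches_runs[OF s3(1) finish_start[OF s3(2)]] by blast
  then have r: "reaches s (?step s4)" by (intro reaches_step)
  define e where "e = d + 2 + (alpha E + 3 * real h * beta E)"
  have 5: "built e i (?step s4 i)" if "i < npes E" for i
    unfolding e_def using finish_step[OF cost 4 that] .
  obtain s5 where "reaches s s5" and s5: "\<And>i. i < npes E \<Longrightarrow> halted build_prog (s5 i) \<and>
      clock (s5 i) \<le> e + 1 \<and> holds_path (residue_tree (npes E) W 0 0) i (s5 i)"
    using reaches_runs[OF r built_end[OF 5]] by blast
  then obtain N where N: "s5 = (?step ^^ N) s" unfolding reaches_def by blast
  then have "all_halted E build_prog ((?step ^^ N) s)"
    using s5 by (simp add: all_halted_def)
  note T = terminates_final[OF this, folded N]
  \<comment> \<open>Apart from \<open>h\<close> the bound has 26 instructions, two one-word messages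
    and one more \<open>alpha E\<close>, together at most
    \<open>26 + 5 * alpha E \<le> 31 * alpha E\<close>. The factor of \<open>h\<close> is at most
    \<open>28 * alpha E\<close>.\<close>
  have "e + 1 \<le> 31 * (alpha E * (1 + real h))"
  proof -
    have a: "1 \<le> alpha E" "round_cost \<le> 2 * alpha E" using cost by (auto simp: round_cost_def)
    have "real h * (2 * round_cost + 15) \<le> real h * (19 * alpha E)"
      using a by (intro mult_left_mono) auto
    moreover have "real h * beta E \<le> real h * alpha E"
      using cost by (intro mult_left_mono) auto
    moreover have "real h * 1 \<le> real h * alpha E"
      using a by (intro mult_left_mono) auto
    ultimately show ?thesis using a by (simp add: e_def d_def c_def algebra_simps)
  qed
  then show ?thesis using T s5 order_trans by blast
qed

end

theorem theorem8:
  shows "\<exists>(build :: instr list) (sampling :: instr list) (C :: real).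
    communication_free sampling \<and>
    (\<forall>(p :: nat) (n :: nat) (own :: nat \<Rightarrow> nat) (w :: nat \<Rightarrow> real).
      1 \<le> p \<longrightarrow> (\<forall>j < n. own j < p) \<longrightarrow> (\<forall>j < n. 0 \<le> w j) \<longrightarrow> 0 < sum w {..<n} \<longrightarrow>
      (\<exists>t. is_dctree p (local_weight n own w) t \<and>
        (\<forall>E. npes E = p \<longrightarrow> 1 \<le> beta E \<longrightarrow> beta E \<le> alpha E \<longrightarrow>
          (\<forall>s. build_start p (local_weight n own w) s \<longrightarrow>
             terminates E build s \<and>
             (\<forall>i < p. clock (final E build s i) \<le> C * (alpha E * (1 + log 2 (real p))) \<and>
                      holds_path t i (final E build s i))) \<and>
          (\<forall>k s. sample_start p t k s \<longrightarrow>
             (AE \<omega> in randomness n own w.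
                terminates (with_randomness E \<omega>) sampling s \<and>
                (\<forall>i < p.
                   clock (final (with_randomness E \<omega>) sampling s i) \<le>
                     loc_time E i (share (fst \<omega>) 1 t k i) + C * (1 + log 2 (real p)) \<and>
                   samples (final (with_randomness E \<omega>) sampling s i) =
                     snd \<omega> (i, share (fst \<omega>) 1 t k i))) \<and>
             (\<lambda>\<omega>. sample_mset E (final (with_randomness E \<omega>) sampling s))
               \<in> randomness n own w \<rightarrow>\<^sub>M count_space UNIV \<and>
             distr (randomness n own w) (count_space UNIV)
                 (\<lambda>\<omega>. sample_mset E (final (with_randomness E \<omega>) sampling s)) =
               measure_pmf (map_pmf mset (replicate_pmf k (weighted_pmf {..<n} w)))))))"
proof -
  have main: "\<exists>t. is_dctree p (local_weight n own w) t \<and>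
        (\<forall>E. npes E = p \<longrightarrow> 1 \<le> beta E \<longrightarrow> beta E \<le> alpha E \<longrightarrow>
          (\<forall>s. build_start p (local_weight n own w) s \<longrightarrow>
             terminates E build_prog s \<and>
             (\<forall>i < p. clock (final E build_prog s i) \<le> 31 * (alpha E * (1 + log 2 (real p))) \<and>
                      holds_path t i (final E build_prog s i))) \<and>
          (\<forall>k s. sample_start p t k s \<longrightarrow>
             (AE \<omega> in randomness n own w.
                terminates (with_randomness E \<omega>) sampling_prog s \<and>
                (\<forall>i < p.
                   clock (final (with_randomness E \<omega>) sampling_prog s i) \<le>
                     loc_time E i (share (fst \<omega>) 1 t k i) + 31 * (1 + log 2 (real p)) \<and>
                   samples (final (with_randomness E \<omega>) sampling_prog s i) =
                     snd \<omega> (i, share (fst \<omega>) 1 t k i))) \<and>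
             (\<lambda>\<omega>. sample_mset E (final (with_randomness E \<omega>) sampling_prog s))
               \<in> randomness n own w \<rightarrow>\<^sub>M count_space UNIV \<and>
             distr (randomness n own w) (count_space UNIV)
                 (\<lambda>\<omega>. sample_mset E (final (with_randomness E \<omega>) sampling_prog s)) =
               measure_pmf (map_pmf mset (replicate_pmf k (weighted_pmf {..<n} w)))))"
    if p: "1 \<le> p" and own: "\<forall>j < n. own j < p" and w: "\<forall>j < n. 0 \<le> w j" "0 < sum w {..<n}"
    for p n :: nat and own :: "nat \<Rightarrow> nat" and w :: "nat \<Rightarrow> real"
  proof -
    define W where "W = local_weight n own w"
    define t where "t = residue_tree p W 0 0"
    obtain h where h: "2 ^ h \<le> p" "p < 2 ^ Suc h"
      using ex_power_ivl1[of 2 p] p by auto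
    have "2 ^ h \<le> real p"
      using h(1) by (metis of_nat_le_iff of_nat_numeral of_nat_power)
    then have log: "real h \<le> log 2 (real p)"
      by (rule le_log_of_power) simp
    have t: "is_dctree p W t" unfolding t_def by (rule is_dctree_residue_tree[OF p])
    then have pes: "distinct (pes t)" "set (pes t) = {..<p}" "stores_weights W t"
      by (auto simp: is_dctree_def)
    have items: "(\<Union>i<p. local_items n own i) = {..<n}"
      using own by (auto simp: local_items_def)
    have disj: "local_items n own i \<inter> local_items n own j = {}" if "i \<noteq> j" for i j
      using that by (auto simp: local_items_def)
    have fin: "finite (local_items n own i)" for i by (simp add: local_items_def)
    have "weight t = (\<Sum>i<p. sum w (local_items n own i))"
      using weight_eq_sum[OF pes(3)] pes(2) by (simp add: W_def local_weight_def)
    also have "\<dots> = sum w {..<n}"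
      unfolding items[symmetric] using fin disj by (intro sum.UNION_disjoint[symmetric]) auto
    \<comment> \<open>Starts the invariant of \<open>draws_pmf_eq\<close> at the root.\<close>
    finally have pos: "0 < weight t" using w(2) by simp
    have build: "terminates E build_prog s \<and>
        (\<forall>i < p. clock (final E build_prog s i) \<le> 31 * (alpha E * (1 + log 2 (real p))) \<and>
          holds_path t i (final E build_prog s i))"
      if E: "npes E = p" "1 \<le> beta E" "beta E \<le> alpha E" and s: "build_start p W s" for E s
    proof -
      have "31 * (alpha E * (1 + real h)) \<le> 31 * (alpha E * (1 + log 2 (real p)))"
        using E log by (intro mult_left_mono) auto
      moreover have "terminates E build_prog s \<and>
          (\<forall>i < p. clock (final E build_prog s i) \<le> 31 * (alpha E * (1 + real h)) \<and>
            holds_path t i (final E build_prog s i))"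
        unfolding t_def E(1)[symmetric] by (rule build_correct) (use E s h in simp_all)
      ultimately show ?thesis using order_trans by blast
    qed
    have sampling: "(AE \<omega> in randomness n own w.
          terminates (with_randomness E \<omega>) sampling_prog s \<and>
          (\<forall>i < p.
             clock (final (with_randomness E \<omega>) sampling_prog s i) \<le>
               loc_time E i (share (fst \<omega>) 1 t k i) + 31 * (1 + log 2 (real p)) \<and>
             samples (final (with_randomness E \<omega>) sampling_prog s i) =
               snd \<omega> (i, share (fst \<omega>) 1 t k i))) \<and>
        (\<lambda>\<omega>. sample_mset E (final (with_randomness E \<omega>) sampling_prog s))
          \<in> randomness n own w \<rightarrow>\<^sub>M count_space UNIV \<and>
        distr (randomness n own w) (count_space UNIV)
            (\<lambda>\<omega>. sample_mset E (final (with_randomness E \<omega>) sampling_prog s)) =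
          measure_pmf (map_pmf mset (replicate_pmf k (weighted_pmf {..<n} w)))"
      if E: "npes E = p" and s: "sample_start p t k s" for E k s
    proof -
      have run: "terminates (with_randomness E \<omega>) sampling_prog s \<and> (\<forall>i < p.
          samples (final (with_randomness E \<omega>) sampling_prog s i) =
            snd \<omega> (i, share (fst \<omega>) 1 t k i) \<and>
          clock (final (with_randomness E \<omega>) sampling_prog s i) =
            18 * real (length (pe_path i t)) + 6 + loc_time E i (share (fst \<omega>) 1 t k i))" for \<omega>
        using sampling_correct[of "with_randomness E \<omega>" t k s] E s by (simp add: with_randomness_def)
      have time: "clock (final (with_randomness E \<omega>) sampling_prog s i) \<le>
          loc_time E i (share (fst \<omega>) 1 t k i) + 31 * (1 + log 2 (real p))" if "i < p" for i \<omega>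
      proof -
        \<comment> \<open>The path has at most \<open>h + 1\<close> entries, so the left side is at
          most \<open>18 * h + 24\<close>.\<close>
        have "18 * real (length (pe_path i t)) + 6 \<le> 31 * (1 + log 2 (real p))"
          using log unfolding t_def pe_path_root[OF h that] by (simp add: path_length_def)
        moreover have "clock (final (with_randomness E \<omega>) sampling_prog s i) =
            18 * real (length (pe_path i t)) + 6 + loc_time E i (share (fst \<omega>) 1 t k i)"
          using run[of \<omega>] that by blast
        ultimately show ?thesis by linarith
      qed
      \<comment> \<open>This holds for every outcome, so measurability and law carry over from
        \<open>draws\<close> without exceptional sets.\<close>
      have draws: "sample_mset E (final (with_randomness E \<omega>) sampling_prog s) =
          draws (fst \<omega>) (snd \<omega>) 1 t k" for \<omega>
        using run[of \<omega>] unfolding draws_eq_sum[OF pes(1)] by (simp add: sample_mset_def E pes(2))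
      have "draws_pmf (\<lambda>i. weighted_pmf (local_items n own i) w) t k =
          sample_pmf k (weighted_pmf (\<Union>i\<in>set (pes t). local_items n own i) w)"
        by (rule draws_pmf_eq)
          (use pes pos fin disj w(1) in \<open>auto simp: W_def local_weight_def[abs_def] local_items_def\<close>)
      then have "distr (randomness n own w) (count_space UNIV)
            (\<lambda>\<omega>. draws (fst \<omega>) (snd \<omega>) 1 t k) =
          measure_pmf (map_pmf mset (replicate_pmf k (weighted_pmf {..<n} w)))"
        using distr_draws[OF pes(1), of 1 n own w k] by (simp add: pes(2) items sample_pmf_def)
      moreover have "(\<lambda>\<omega>. draws (fst \<omega>) (snd \<omega>) 1 t k)
          \<in> randomness n own w \<rightarrow>\<^sub>M count_space UNIV"
        using measurable_draws[of 1 t k n own w] by (simp add: randomness_def case_prod_unfold)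
      ultimately show ?thesis
        unfolding draws using run time by (intro conjI AE_I2) auto
    qed
    show ?thesis
      using t build sampling unfolding W_def by blast
  qed
  show ?thesis
    by (intro exI[of _ build_prog] exI[of _ sampling_prog] exI[of _ 31] conjI allI impI main)
      (simp add: communication_free_def sampling_prog_def, blast+)
qed

end
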